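(* Let $\mathbb{K}$ be a field and let $G$ be a connected graph with vertex set $[\ell]=\{1,\dots,\ell\}$. Then $$D_R(\mathcal{A}_G)\cong \mathbb{K}[P_G]$$ as $R$-modules.
   Context: Graphs are finite and simple, $\ell\ge 1$. $S=\mathbb{K}[x_1,\dots,x_\ell]$, $\mathrm{Der}(S)=\bigoplus_{i=1}^\ell S\,\partial_{x_i}$, and $R=\mathbb{K}[x_i-x_j\mid 1\le i<j\le \ell]\subset S$ (the subalgebra generated by the differences). The graphic arrangement of $G$ is $\mathcal{A}_G=\{H_{x_u-x_v}\subset\mathbb{K}^\ell \mid \{u,v\}\text{ an edge of }G\}$, where $H_\alpha$ is the hyperplane defined by the linear form $\alpha$. Its logarithmic vector field is the $S$-module $D(\mathcal{A}_G)=\{\theta\in \mathrm{Der}(S)\mid \theta(x_u-x_v)\in (x_u-x_v)S \text{ for every edge }\{u,v\}\text{ of }G\}$, and $D_R(\mathcal{A}_G)=D(\mathcal{A}_G)\cap\big(\bigoplus_{i=1}^\ell R\,\partial_{x_i}\big)$, an $R$-module. The poset $P_G$: $P_G=\{(V(C),T)\mid T\subsetneq[\ell],\ C \text{ a connected component of } G-T\}$, where $G-T$ is the graph obtained from $G$ by deleting the vertices in $T$ and $V(C)$ is the vertex set of $C$; the order is $(W,T)\le (W',T')$ iff $W\supset W'$ and $T\subset T'$ (inclusions not necessarily strict). For connected $G$ this is a simplicial poset with minimal element $([\ell],\emptyset)$. A simplicial poset $P$ is a finite poset with a minimal element $\hat 0$ such that every interval $[\hat 0,\sigma]$ is a Boolean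 algebra; if two elements $\sigma,\tau$ have a common upper bound then they have a meet $\sigma\wedge\tau$. The face ring of $P$ is $\mathbb{K}[P]=\mathbb{K}[x_\sigma\mid\sigma\in P]/I_P$, where $I_P$ is the ideal generated by: $x_{\hat 0}-1$; $x_\sigma x_\tau$ for all $\sigma,\tau$ with no common upper bound; and $x_\sigma x_\tau-x_{\sigma\wedge\tau}\sum_\rho x_\rho$ for all $\sigma,\tau$ having a common upper bound, where $\rho$ runs over all minimal common upper bounds of $\sigma$ and $\tau$. $\mathbb{K}[P_G]$ is regarded as an $S$-module (hence as an $R$-module by restriction) by letting $x_i$ act as multiplication by $\sum_{(W,T)\in P_G,\ T=\{i\}}x_{(W,T)}$. *)

theory Defs
  imports
    "HOL-Library.Poly_Mapping"
    "HOL-Algebra.Module"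
    "HOL-Algebra.Lattice"
    "HOL-Algebra.QuotRing"
    "HOL-Algebra.Generated_Rings"
    "Graph_Theory.Digraph_Component"
begin

section \<open>Polynomial rings\<close>

text \<open>
  A polynomial over \<open>'k\<close> in variables from \<open>'v\<close> is a finitely supported function from monomials
  \<open>'v \<Rightarrow>\<^sub>0 nat\<close> to \<open>'k\<close>; \<^theory>\<open>HOL-Library.Poly_Mapping\<close> supplies its convolution product.
\<close>

type_synonym ('v, 'k) mpoly = "('v \<Rightarrow>\<^sub>0 nat) \<Rightarrow>\<^sub>0 'k"

definition Var :: "'v \<Rightarrow> ('v, 'k::field) mpoly" where
  "Var v = Poly_Mapping.single (Poly_Mapping.single v 1) 1"

definition Const :: "'k \<Rightarrow> ('v, 'k::field) mpoly" where
  "Const c = Poly_Mapping.single 0 c"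

definition mpoly_ring :: "'v set \<Rightarrow> ('v, 'k::field) mpoly ring" where
  "mpoly_ring V =
    \<lparr>carrier = {p. \<forall>m \<in> Poly_Mapping.keys p. Poly_Mapping.keys m \<subseteq> V},
     monoid.mult = (*), one = 1, zero = 0, add = (+)\<rparr>"

definition mpoly_subst :: "('v \<Rightarrow> ('w, 'k) mpoly) \<Rightarrow> ('v, 'k::field) mpoly \<Rightarrow> ('w, 'k) mpoly" where
  "mpoly_subst g p = (\<Sum>m \<in> Poly_Mapping.keys p.
     Const (Poly_Mapping.lookup p m) *
       (\<Prod>v \<in> Poly_Mapping.keys m. g v ^ Poly_Mapping.lookup m v))"

text \<open>
  The formal partial derivative. The truncated exponent subtraction is harmless: a monomial not
  containing \<open>v\<close> gets the coefficient 0.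
\<close>

definition partial_deriv :: "'v \<Rightarrow> ('v, 'k::field) mpoly \<Rightarrow> ('v, 'k) mpoly" where
  "partial_deriv v p = (\<Sum>m \<in> Poly_Mapping.keys p.
     Poly_Mapping.single (m - Poly_Mapping.single v 1)
       (of_nat (Poly_Mapping.lookup m v) * Poly_Mapping.lookup p m))"

definition S_ring :: "nat \<Rightarrow> (nat, 'k::field) mpoly ring" where
  "S_ring l = mpoly_ring {1..l}"

text \<open>A subalgebra is a subring containing the constants, which are therefore added as generators.\<close>

definition R_ring :: "nat \<Rightarrow> (nat, 'k::field) mpoly ring" where
  "R_ring l = S_ring l
    \<lparr>carrier := generate_ring (S_ring l)
       (range Const \<union> {Var i - Var j | i j. 1 \<le> i \<and> i < j \<and> j \<le> l})\<rparr>"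


section \<open>Isomorphism of modules\<close>

definition module_iso ::
    "('r, 'x) ring_scheme \<Rightarrow> ('r, 'm, 'y) module_scheme \<Rightarrow> ('r, 'n, 'z) module_scheme \<Rightarrow> ('m \<Rightarrow> 'n) set"
  where
  "module_iso R M N =
    {f. bij_betw f (carrier M) (carrier N) \<and>
        (\<forall>x \<in> carrier M. \<forall>y \<in> carrier M. f (x \<oplus>\<^bsub>M\<^esub> y) = f x \<oplus>\<^bsub>N\<^esub> f y) \<and>
        (\<forall>r \<in> carrier R. \<forall>x \<in> carrier M. f (r \<odot>\<^bsub>M\<^esub> x) = r \<odot>\<^bsub>N\<^esub> f x)}"

definition isomorphic_modules ::
    "('r, 'x) ring_scheme \<Rightarrow> ('r, 'm, 'y) module_scheme \<Rightarrow> ('r, 'n, 'z) module_scheme \<Rightarrow> bool"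
  where
  "isomorphic_modules R M N \<longleftrightarrow> module R M \<and> module R N \<and> module_iso R M N \<noteq> {}"


section \<open>Logarithmic vector fields of graphic arrangements\<close>

text \<open>
  \<open>derivation l f\<close> is the operator \<open>\<Sum>i. f i \<partial>\<^sub>i\<close> on \<open>S\<close>, as an extensional function, so that
  distinct elements of \<open>Der S\<close> are distinct functions. \<open>derivations l A\<close> is \<open>\<Oplus>i. A \<partial>\<^sub>i\<close>; in
  particular \<open>derivations l (carrier (S_ring l))\<close> is \<open>Der S\<close>.
\<close>

definition derivation ::
    "nat \<Rightarrow> (nat \<Rightarrow> (nat, 'k::field) mpoly) \<Rightarrow> (nat, 'k) mpoly \<Rightarrow> (nat, 'k) mpoly" where
  "derivation l f = (\<lambda>p \<in> carrier (S_ring l). \<Sum>i = 1..l. f i * partial_deriv i p)"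

definition derivations ::
    "nat \<Rightarrow> (nat, 'k::field) mpoly set \<Rightarrow> ((nat, 'k) mpoly \<Rightarrow> (nat, 'k) mpoly) set" where
  "derivations l A = derivation l ` Pi {1..l} (\<lambda>_. A)"

text \<open>
  Graphs are symmetric loop-free digraphs without multiple arcs (locale \<open>graph\<close>), so \<open>{u, v}\<close> is
  an edge iff \<open>(u, v) \<in> arcs_ends G\<close>.
\<close>

definition log_derivations ::
    "nat \<Rightarrow> (nat, 'b) pre_digraph \<Rightarrow> ((nat, 'k::field) mpoly \<Rightarrow> (nat, 'k) mpoly) set" where
  "log_derivations l G =
    {\<theta> \<in> derivations l (carrier (S_ring l)).
      \<forall>(u, v) \<in> arcs_ends G. \<theta> (Var u - Var v) \<in> PIdl\<^bsub>S_ring l\<^esub> (Var u - Var v)}"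

text \<open>The fields \<open>mult\<close> and \<open>one\<close>, inherited from the ring record, play no role in a module.\<close>

definition D_R ::
    "nat \<Rightarrow> (nat, 'b) pre_digraph \<Rightarrow>
      ((nat, 'k::field) mpoly, (nat, 'k) mpoly \<Rightarrow> (nat, 'k) mpoly) module" where
  "D_R l G =
    \<lparr>carrier = log_derivations l G \<inter> derivations l (carrier (R_ring l)),
     monoid.mult = undefined, one = undefined,
     zero = (\<lambda>p \<in> carrier (S_ring l). 0),
     add = (\<lambda>\<theta> \<eta>. \<lambda>p \<in> carrier (S_ring l). \<theta> p + \<eta> p),
     smult = (\<lambda>r \<theta>. \<lambda>p \<in> carrier (S_ring l). r * \<theta> p)\<rparr>"


section \<open>Face rings\<close>

definition minimal_upper_bounds :: "('p, 'c) gorder_scheme \<Rightarrow> 'p \<Rightarrow> 'p \<Rightarrow> 'p set" where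
  "minimal_upper_bounds L s t =
    {r \<in> Upper L {s, t}. \<forall>r' \<in> Upper L {s, t}. r' \<sqsubseteq>\<^bsub>L\<^esub> r \<longrightarrow> r' = r}"

definition face_relations :: "('p, 'c) gorder_scheme \<Rightarrow> ('p, 'k::field) mpoly set" where
  "face_relations L =
    {Var \<bottom>\<^bsub>L\<^esub> - 1} \<union>
    {Var s * Var t | s t. s \<in> carrier L \<and> t \<in> carrier L \<and> Upper L {s, t} = {}} \<union>
    {Var s * Var t - Var (s \<sqinter>\<^bsub>L\<^esub> t) * (\<Sum>r \<in> minimal_upper_bounds L s t. Var r) | s t.
       s \<in> carrier L \<and> t \<in> carrier L \<and> Upper L {s, t} \<noteq> {}}"

definition face_ideal :: "('p, 'c) gorder_scheme \<Rightarrow> ('p, 'k::field) mpoly set" where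
  "face_ideal L = Idl\<^bsub>mpoly_ring (carrier L)\<^esub> (face_relations L)"

definition face_ring :: "('p, 'c) gorder_scheme \<Rightarrow> ('p, 'k::field) mpoly set ring" where
  "face_ring L = mpoly_ring (carrier L) Quot face_ideal L"


section \<open>The poset of a graph\<close>

text \<open>
  Strong and weak connectedness agree for symmetric digraphs, so the strongly connected components
  (\<open>sccs\<close>) of \<open>G - T\<close> are its connected components.
\<close>

definition graph_poset :: "('a, 'b) pre_digraph \<Rightarrow> ('a set \<times> 'a set) gorder" where
  "graph_poset G =
    \<lparr>carrier = {(verts C, T) | C T. T \<subset> verts G \<and> C \<in> pre_digraph.sccs (G \<restriction> (verts G - T))},
     eq = (=),
     le = (\<lambda>(W, T) (W', T'). W' \<subseteq> W \<and> T \<subseteq> T')\<rparr>"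

definition vertex_sum :: "('a, 'b) pre_digraph \<Rightarrow> 'a \<Rightarrow> ('a set \<times> 'a set, 'k::field) mpoly" where
  "vertex_sum G i = (\<Sum>s \<in> {s \<in> carrier (graph_poset G). snd s = {i}}. Var s)"

text \<open>
  The face ring of \<open>graph_poset G\<close> as a module over polynomials in the vertices: \<open>p\<close> acts as
  multiplication by the class of \<open>p\<close> with \<open>vertex_sum G i\<close> substituted for each \<open>x\<^sub>i\<close>.
\<close>

definition face_module ::
    "('a, 'b) pre_digraph \<Rightarrow> (('a, 'k::field) mpoly, ('a set \<times> 'a set, 'k) mpoly set) module" where
  "face_module G = ring.extend (face_ring (graph_poset G))
    \<lparr>smult = (\<lambda>p c.
       (face_ideal (graph_poset G) +>\<^bsub>mpoly_ring (carrier (graph_poset G))\<^esub>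
          mpoly_subst (vertex_sum G) p)
       \<otimes>\<^bsub>face_ring (graph_poset G)\<^esub> c)\<rparr>"

end

theory Submission
  imports Defs
begin

text \<open>
  Write \<open>V\<close> for the vertex set. A field \<open>\<Sum>v. f v \<partial>\<^sub>v\<close> with coefficients in \<open>R\<close> is logarithmic iff
  \<open>x\<^sub>u - x\<^sub>v\<close> divides \<open>f u - f v\<close> for every edge: the coefficient family is a \<^emph>\<open>spline\<close> on the graph.
  The maximal elements of the poset are the pairs \<open>({v}, V - {v})\<close>, one for each vertex. Restricting
  an element of the face ring to the face of \<open>v\<close> gives a polynomial in the variables \<open>x\<^sub>i\<close>, \<open>i \<noteq> v\<close>,
  and \<open>x\<^sub>i \<mapsto> x\<^sub>i - x\<^sub>v\<close> identifies such polynomials with \<open>R\<close>. The resulting homomorphism sends the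
  variable of \<open>(W, T)\<close> to \<open>\<Prod>i\<in>T. (x\<^sub>i - x\<^sub>v)\<close> if \<open>v \<in> W\<close> and to \<open>0\<close> otherwise. These restrictions
  (\<open>facet_restriction\<close>), taken over all \<open>v\<close>, map the face ring isomorphically onto the splines, because
  both sides have a basis indexed by the pairs \<open>(m, C)\<close> of a monomial \<open>m\<close> and a component \<open>C\<close> of
  \<open>G - T\<close>, where \<open>T \<subset> V\<close> is the support of \<open>m\<close>.

  \<^item> Splines. An element of \<open>R\<close> is invariant under translations, so it is determined by its
    coefficients at the monomials without \<open>x\<^sub>v\<close>, for any one \<open>v\<close> (\<open>difference_polys_eqI\<close>). Setting
    \<open>x\<^sub>u = x\<^sub>v = 0\<close> in the divisibility condition shows that \<open>f u\<close> and \<open>f v\<close> have the same coefficient at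
    each monomial without \<open>x\<^sub>u\<close> and \<open>x\<^sub>v\<close>. Hence the coefficient of \<open>f v\<close> at \<open>m\<close>, as a function of
    \<open>v \<in> V - T\<close>, is constant on every component of \<open>G - T\<close> (\<open>spline_lookup_eq\<close>).

  \<^item> The face ring. Let \<open>\<theta>\<^sub>i\<close> be the sum of the variables of the pairs with second entry \<open>{i}\<close>. The
    relations of the face ring imply
    \<open>x\<^bsub>(C, T)\<^esub> x\<^bsub>(D, U)\<^esub> = (\<Prod>i\<in>T \<inter> U. \<theta>\<^sub>i) (\<Sum>E. x\<^bsub>(E, T \<union> U)\<^esub>)\<close>, the sum over the components \<open>E\<close>
    of \<open>G - (T \<union> U)\<close> inside \<open>C \<inter> D\<close> (\<open>Var_mult_Var_cong\<close>). It follows that the standard monomials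
    \<open>x\<^bsub>(C, T)\<^esub> \<Prod>i\<in>T. \<theta>\<^sub>i\<^bsup>m i - 1\<^esup>\<close> span the face ring (\<open>polys_in_standard_combinations\<close>). The
    restriction of the standard monomial of \<open>(m, C)\<close> to \<open>v\<close> is \<open>m\<close>, with \<open>x\<^sub>i - x\<^sub>v\<close> in place of \<open>x\<^sub>i\<close>,
    if \<open>v \<in> C\<close>, and \<open>0\<close> otherwise, so these elements correspond to the basis of the splines.

  Finally \<open>\<theta>\<^sub>i\<close> restricts to \<open>x\<^sub>i - x\<^sub>v\<close>, and substituting \<open>x\<^sub>i - x\<^sub>v\<close> for \<open>x\<^sub>i\<close> fixes the elements of
  \<open>R\<close>; this makes the correspondence \<open>R\<close>-linear.
\<close>

section \<open>Polynomials and substitution\<close>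

abbreviation "lookup \<equiv> Poly_Mapping.lookup"
abbreviation "keys \<equiv> Poly_Mapping.keys"

definition power_product :: "('v \<Rightarrow> ('w, 'k::field) mpoly) \<Rightarrow> ('v \<Rightarrow>\<^sub>0 nat) \<Rightarrow> ('w, 'k) mpoly" where
  "power_product g m = (\<Prod>v\<in>keys m. g v ^ lookup m v)"

lemma power_product_superset:
  assumes "finite A" "keys m \<subseteq> A"
  shows "power_product g m = (\<Prod>v\<in>A. g v ^ lookup m v)"
  unfolding power_product_def
  by (rule prod.mono_neutral_left[OF assms]) (auto simp: in_keys_iff)

lemma keys_add_nat: "keys (m + n :: 'v \<Rightarrow>\<^sub>0 nat) = keys m \<union> keys n"
  by (auto simp: in_keys_iff lookup_add)

lemma power_product_add: "power_product g (m + n) = power_product g m * power_product g n"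
proof -
  let ?A = "keys m \<union> keys n"
  have "power_product g (m + n) = (\<Prod>v\<in>?A. g v ^ lookup (m + n) v)"
    by (rule power_product_superset) (auto simp: keys_add_nat)
  also have "\<dots> = (\<Prod>v\<in>?A. g v ^ lookup m v) * (\<Prod>v\<in>?A. g v ^ lookup n v)"
    by (simp add: lookup_add power_add prod.distrib)
  also have "\<dots> = power_product g m * power_product g n"
    by (simp add: power_product_superset[of ?A])
  finally show ?thesis .
qed

lemma power_product_zero [simp]: "power_product g 0 = 1"
  by (simp add: power_product_def)

lemma power_product_single [simp]: "power_product g (Poly_Mapping.single v n) = g v ^ n"
  by (simp add: power_product_superset[of "{v}"])

lemma Const_add: "Const (a + b) = Const a + Const b"
  by (simp add: Const_def single_add)

lemma Const_mult: "Const (a * b) = Const a * Const b"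
  by (simp add: Const_def mult_single)

lemma Const_zero [simp]: "Const 0 = 0" and Const_one [simp]: "Const 1 = 1"
  by (simp_all add: Const_def)

lemma prod_single_one:
  "finite A \<Longrightarrow> (\<Prod>v\<in>A. Poly_Mapping.single (f v) 1) = Poly_Mapping.single (\<Sum>v\<in>A. f v) (1::'k::field)"
  for f :: "'v \<Rightarrow> 'w \<Rightarrow>\<^sub>0 nat"
  by (induction A rule: finite_induct) (auto simp: mult_single)

lemma single_one_power: "Poly_Mapping.single m 1 ^ n = Poly_Mapping.single (\<Sum>i<n. m) (1::'k::field)"
  for m :: "'w \<Rightarrow>\<^sub>0 nat"
  by (induction n) (auto simp: mult_single add.commute)

lemma sum_const_single: "(\<Sum>i<n. Poly_Mapping.single v (1::nat)) = Poly_Mapping.single v n"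
  by (rule poly_mapping_eqI) (auto simp: lookup_sum lookup_single when_def)

lemma lookup_sum_single_one:
  "finite U \<Longrightarrow> lookup (\<Sum>i\<in>U. Poly_Mapping.single i (1::nat)) j = (if j \<in> U then 1 else 0)"
  by (simp add: lookup_sum lookup_single when_def)

lemma keys_add_sum_single_one:
  assumes "finite U"
  shows "keys (m + (\<Sum>i\<in>U. Poly_Mapping.single i (1::nat))) = keys m \<union> U"
  by (auto simp: in_keys_iff lookup_add lookup_sum_single_one[OF assms] split: if_splits simp del: One_nat_def)

lemma sum_keys_single: "(\<Sum>v\<in>keys m. Poly_Mapping.single v (lookup m v)) = m"
  by (rule poly_mapping_eqI) (auto simp: lookup_sum lookup_single when_def in_keys_iff)

lemma Var_power: "Var v ^ n = (Poly_Mapping.single (Poly_Mapping.single v n) 1 :: ('v, 'k::field) mpoly)"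
  by (simp only: Var_def single_one_power sum_const_single)

lemma power_product_Var: "power_product Var m = (Poly_Mapping.single m 1 :: ('v, 'k::field) mpoly)"
  by (simp add: power_product_def Var_power prod_single_one sum_keys_single)

lemma single_eq_power_product: "Poly_Mapping.single m c = Const c * power_product Var m"
  by (simp add: power_product_Var Const_def mult_single)

lemma sum_monomials: "(\<Sum>m\<in>keys p. Const (lookup p m) * power_product Var m) = p"
  for p :: "('v, 'k::field) mpoly"
  by (simp add: sum_keys_single flip: single_eq_power_product)

lemma mpoly_subst_Var_self [simp]: "mpoly_subst Var p = p"
  using sum_monomials[of p] by (simp add: mpoly_subst_def power_product_def)

section \<open>Polynomials in a given set of variables\<close>

lemma mpoly_ring_simps [simp]:
  "monoid.mult (mpoly_ring V) = (*)" "one (mpoly_ring V) = 1"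
  "zero (mpoly_ring V) = 0" "add (mpoly_ring V) = (+)"
  by (simp_all add: mpoly_ring_def)

abbreviation polys :: "'v set \<Rightarrow> ('v, 'k::field) mpoly set" where
  "polys V \<equiv> carrier (mpoly_ring V)"

lemma polys_iff: "p \<in> polys V \<longleftrightarrow> (\<forall>m\<in>keys p. keys m \<subseteq> V)"
  by (simp add: mpoly_ring_def)

lemma polys_UNIV [simp]: "p \<in> polys UNIV"
  by (simp add: polys_iff)

lemma polys_Const [simp, intro]: "Const c \<in> polys V"
  by (simp add: polys_iff Const_def)

lemma polys_zero [simp, intro]: "0 \<in> polys V" and polys_one [simp, intro]: "1 \<in> polys V"
  using polys_Const[of 0 V] polys_Const[of 1 V] by auto

lemma polys_Var [simp]: "Var v \<in> (polys V :: ('v, 'k::field) mpoly set) \<longleftrightarrow> v \<in> V"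
  by (simp add: polys_iff Var_def)

lemma polys_add [simp, intro]: "p \<in> polys V \<Longrightarrow> q \<in> polys V \<Longrightarrow> p + q \<in> polys V"
  unfolding polys_iff using Poly_Mapping.keys_add[of p q] by blast

lemma polys_uminus [simp, intro]: "p \<in> polys V \<Longrightarrow> - p \<in> polys V"
  by (simp add: polys_iff in_keys_iff)

lemma polys_diff [simp, intro]: "p \<in> polys V \<Longrightarrow> q \<in> polys V \<Longrightarrow> p - q \<in> polys V"
  using polys_add[of p V "- q"] by simp

lemma polys_mult [simp, intro]:
  assumes "p \<in> polys V" "q \<in> polys V" shows "p * q \<in> polys V"
  unfolding polys_iff
proof
  fix m assume "m \<in> keys (p * q)"
  then obtain a b where "m = a + b" "a \<in> keys p" "b \<in> keys q"
    using keys_mult[of p q] by auto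
  with assms show "keys m \<subseteq> V"
    by (auto simp: polys_iff keys_add_nat)
qed

lemma polys_power [simp, intro]: "p \<in> polys V \<Longrightarrow> p ^ n \<in> polys V"
  by (induction n) auto

lemma polys_sum [intro]: "(\<And>i. i \<in> A \<Longrightarrow> f i \<in> polys V) \<Longrightarrow> sum f A \<in> polys V"
  by (induction A rule: infinite_finite_induct) auto

lemma polys_prod [intro]: "(\<And>i. i \<in> A \<Longrightarrow> f i \<in> polys V) \<Longrightarrow> prod f A \<in> polys V"
  by (induction A rule: infinite_finite_induct) auto

lemma cring_mpoly_ring: "cring (mpoly_ring V :: ('v, 'k::field) mpoly ring)"
proof (rule cringI)
  have "\<exists>q\<in>polys V. q + p = 0" if "p \<in> polys V" for p :: "('v, 'k) mpoly"
    by (rule bexI[of _ "- p"]) (use that in auto)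
  then show "abelian_group (mpoly_ring V :: ('v, 'k) mpoly ring)"
    by (intro abelian_groupI) (auto simp: add_ac)
  show "comm_monoid (mpoly_ring V :: ('v, 'k) mpoly ring)"
    by (intro comm_monoidI) (auto simp: mult_ac)
qed (simp add: ring_distribs)

lemma mpoly_ring_a_inv: "p \<in> polys V \<Longrightarrow> \<ominus>\<^bsub>mpoly_ring V\<^esub> p = - p"
  using cring.axioms(1)[OF cring_mpoly_ring, of V]
  by (intro abelian_group.minus_equality) (auto simp: ring_def)

text \<open>
  Since constants, sums and multiplication by one variable at a time generate all polynomials,
  two ring homomorphisms that agree on constants and variables agree.
\<close>

lemma mpoly_induct [consumes 1, case_names Const add mult_Var]:
  assumes p: "p \<in> polys V"
    and Const: "\<And>c. P (Const c)"
    and add: "\<And>p q. p \<in> polys V \<Longrightarrow> q \<in> polys V \<Longrightarrow> P p \<Longrightarrow> P q \<Longrightarrow> P (p + q)"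
    and mult_Var: "\<And>p v. p \<in> polys V \<Longrightarrow> v \<in> V \<Longrightarrow> P p \<Longrightarrow> P (p * Var v)"
  shows "P p"
proof -
  have pow: "P (p * Var v ^ n) \<and> p * Var v ^ n \<in> polys V" if "p \<in> polys V" "P p" "v \<in> V" for p v n
  proof (induction n)
    case (Suc n)
    then show ?case
      using mult_Var[of "p * Var v ^ n" v] that by (auto simp: mult_ac)
  qed (use that in auto)
  have monom: "P (Const c * (\<Prod>v\<in>A. Var v ^ e v))" if "finite A" "A \<subseteq> V" for c e A
    using that
  proof (induction A rule: finite_induct)
    case (insert v A)
    have "Const c * (\<Prod>v\<in>A. Var v ^ e v) \<in> polys V"
      using insert.prems by (intro polys_mult polys_prod) auto
    then have "P ((Const c * (\<Prod>v\<in>A. Var v ^ e v)) * Var v ^ e v)"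
      using pow insert by blast
    with insert.hyps show ?case by (simp add: mult_ac)
  qed (simp add: Const)
  have "P (\<Sum>m\<in>A. Const (lookup p m) * power_product Var m)" if "finite A" "A \<subseteq> keys p" for A
    using that
  proof (induction A rule: finite_induct)
    case empty
    show ?case using Const[of 0] by simp
  next
    case (insert m A)
    have sub: "keys m' \<subseteq> V" if "m' \<in> insert m A" for m'
      using p insert.prems that by (auto simp: polys_iff)
    have "Const (lookup p m') * power_product Var m' \<in> polys V" if "m' \<in> insert m A" for m'
      unfolding power_product_def using sub[OF that] by (intro polys_mult polys_prod) auto
    moreover have "P (Const (lookup p m) * power_product Var m)"
      unfolding power_product_def using sub by (intro monom) auto
    ultimately show ?case
      using insert by (auto intro!: add polys_sum)
  qed
  from this[of "keys p"] show ?thesis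
    by (simp add: sum_monomials)
qed

section \<open>Substitution as a ring homomorphism\<close>

lemma mpoly_subst_add [simp]: "mpoly_subst g (p + q) = mpoly_subst g p + mpoly_subst g q"
  unfolding mpoly_subst_def
  by (rule setsum_keys_plus_distrib) (auto simp: Const_add ring_distribs)

lemma mpoly_subst_single:
  "mpoly_subst g (Poly_Mapping.single m c) = Const c * power_product g m"
  by (simp add: mpoly_subst_def power_product_def)

lemma mpoly_subst_Const [simp]: "mpoly_subst g (Const c) = Const c"
  using mpoly_subst_single[of g 0 c] by (simp add: Const_def)

lemma mpoly_subst_Var [simp]: "mpoly_subst g (Var v) = g v"
  by (simp add: Var_def mpoly_subst_single)

lemma mpoly_subst_zero [simp]: "mpoly_subst g 0 = 0"
  and mpoly_subst_one [simp]: "mpoly_subst g 1 = 1"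
  using mpoly_subst_Const[of g 0] mpoly_subst_Const[of g 1] by simp_all

lemma mpoly_subst_uminus [simp]: "mpoly_subst g (- p) = - mpoly_subst g p"
  using mpoly_subst_add[of g p "- p"] by (simp add: eq_neg_iff_add_eq_0 add.commute del: mpoly_subst_add)

lemma mpoly_subst_diff [simp]: "mpoly_subst g (p - q) = mpoly_subst g p - mpoly_subst g q"
  using mpoly_subst_add[of g p "- q"] by simp

lemma mpoly_subst_sum [simp]: "mpoly_subst g (sum f A) = (\<Sum>i\<in>A. mpoly_subst g (f i))"
  by (induction A rule: infinite_finite_induct) auto

lemma mpoly_subst_mult_Var: "mpoly_subst g (p * Var v) = mpoly_subst g p * g v"
proof -
  have "mpoly_subst g ((Const c * power_product Var m) * Var v) = Const c * power_product g m * g v" for c m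
    using mpoly_subst_single[of g "m + Poly_Mapping.single v 1" c]
    by (simp add: power_product_Var Const_def Var_def mult_single power_product_add mult_ac)
  moreover have "mpoly_subst g p * g v = (\<Sum>m\<in>keys p. Const (lookup p m) * power_product g m * g v)"
    by (simp add: mpoly_subst_def sum_distrib_right power_product_def)
  moreover have "p * Var v = (\<Sum>m\<in>keys p. Const (lookup p m) * power_product Var m * Var v)"
    by (simp add: sum_monomials flip: sum_distrib_right)
  ultimately show ?thesis by simp
qed

text \<open>
  Multiplication by a variable shifts the exponents and needs only \<open>power_product_add\<close>; the general
  product follows by induction on the second factor.
\<close>

lemma mpoly_subst_mult [simp]: "mpoly_subst g (p * q) = mpoly_subst g p * mpoly_subst g q"
proof -
  have const: "mpoly_subst g (p * Const c) = mpoly_subst g p * Const c" for p c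
    using polys_UNIV[of p]
  proof (induction p rule: mpoly_induct)
    case (mult_Var p v)
    have "mpoly_subst g (p * Var v * Const c) = mpoly_subst g (p * Const c * Var v)"
      by (simp only: mult.assoc mult.commute[of "Var v"])
    also have "\<dots> = mpoly_subst g (p * Var v) * Const c"
      unfolding mpoly_subst_mult_Var mult_Var by (simp only: mult.assoc mult.commute[of "g v"])
    finally show ?case .
  qed (simp_all add: ring_distribs flip: Const_mult)
  show ?thesis using polys_UNIV[of q]
    by (induction q rule: mpoly_induct)
      (simp_all add: const ring_distribs mpoly_subst_mult_Var flip: mult.assoc)
qed

lemma mpoly_subst_power [simp]: "mpoly_subst g (p ^ n) = mpoly_subst g p ^ n"
  by (induction n) auto

lemma mpoly_subst_prod [simp]: "mpoly_subst g (prod f A) = (\<Prod>i\<in>A. mpoly_subst g (f i))"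
  by (induction A rule: infinite_finite_induct) auto

lemma mpoly_subst_cong:
  assumes "p \<in> polys V" "\<And>v. v \<in> V \<Longrightarrow> g v = h v"
  shows "mpoly_subst g p = mpoly_subst h p"
  using assms(1) by (induction p rule: mpoly_induct) (auto simp: assms(2))

lemma mpoly_subst_in_polys:
  assumes "p \<in> polys V" "\<And>v. v \<in> V \<Longrightarrow> g v \<in> polys W"
  shows "mpoly_subst g p \<in> polys W"
  using assms(1) by (induction p rule: mpoly_induct) (auto simp: assms(2))

lemma mpoly_subst_mpoly_subst:
  "mpoly_subst g (mpoly_subst h p) = mpoly_subst (\<lambda>v. mpoly_subst g (h v)) p"
  using polys_UNIV[of p] by (induction p rule: mpoly_induct) auto

text \<open>
  Modulo \<open>a\<close> the two substitutions agree on the variables, hence everywhere. For a product this uses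
  \<open>p q - p' q' = (p - p') q + p' (q - q')\<close>.
\<close>

lemma dvd_mpoly_subst_diff:
  assumes "p \<in> polys V" "\<And>v. v \<in> V \<Longrightarrow> a dvd g v - h v"
  shows "a dvd mpoly_subst g p - mpoly_subst h p"
  using assms(1)
proof (induction p rule: mpoly_induct)
  case (add p q)
  have "mpoly_subst g (p + q) - mpoly_subst h (p + q)
      = (mpoly_subst g p - mpoly_subst h p) + (mpoly_subst g q - mpoly_subst h q)" by simp
  with add show ?case by (simp only: dvd_add)
next
  case (mult_Var p v)
  have "mpoly_subst g (p * Var v) - mpoly_subst h (p * Var v)
      = (mpoly_subst g p - mpoly_subst h p) * g v + mpoly_subst h p * (g v - h v)"
    by (simp add: algebra_simps)
  with mult_Var assms(2) show ?case by (simp only: dvd_add dvd_mult dvd_mult2)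
qed simp

definition set_to_zero :: "'v set \<Rightarrow> ('v, 'k::field) mpoly \<Rightarrow> ('v, 'k) mpoly" where
  "set_to_zero A = mpoly_subst (\<lambda>v. if v \<in> A then 0 else Var v)"

lemma lookup_Const_mult: "lookup (Const c * p) m = c * lookup p m"
  unfolding Const_def mult_map_scale_conv_mult[symmetric]
  by transfer (simp add: when_def)

lemma lookup_set_to_zero:
  fixes p :: "('v, 'k::field) mpoly"
  shows "lookup (set_to_zero A p) m = (if keys m \<inter> A = {} then lookup p m else 0)"
proof -
  let ?g = "\<lambda>v. if v \<in> A then 0 else Var v :: ('v, 'k) mpoly"
  have pp: "power_product ?g m' = (if keys m' \<inter> A = {} then Poly_Mapping.single m' 1 else 0)" for m'
  proof (cases "keys m' \<inter> A = {}")
    case True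
    then have "power_product ?g m' = power_product Var m'"
      unfolding power_product_def by (intro prod.cong) auto
    with True show ?thesis by (simp add: power_product_Var)
  next
    case False
    then obtain v where "v \<in> keys m'" "v \<in> A" by auto
    then have "power_product ?g m' = 0"
      unfolding power_product_def by (intro prod_zero) (auto simp: in_keys_iff zero_power intro!: bexI[of _ v])
    with False show ?thesis by simp
  qed
  have "set_to_zero A p = (\<Sum>m'\<in>keys p. Const (lookup p m') * power_product ?g m')"
    by (simp add: set_to_zero_def mpoly_subst_def power_product_def)
  then have "lookup (set_to_zero A p) m = (\<Sum>m'\<in>keys p. lookup p m' * lookup (power_product ?g m') m)"
    by (simp add: lookup_sum lookup_Const_mult)
  also have "\<dots> = (\<Sum>m'\<in>keys p. if m' = m then (if keys m \<inter> A = {} then lookup p m else 0) else 0)"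
    by (intro sum.cong) (auto simp: pp lookup_single when_def)
  also have "\<dots> = (if keys m \<inter> A = {} then lookup p m else 0)"
    by (simp add: in_keys_iff)
  finally show ?thesis .
qed

lemma set_to_zero_in_polys: "p \<in> polys V \<Longrightarrow> set_to_zero (- W) p \<in> polys W"
  by (auto simp: set_to_zero_def intro!: mpoly_subst_in_polys[of _ UNIV])

lemma set_to_zero_eq: "p \<in> polys V \<Longrightarrow> A \<inter> V = {} \<Longrightarrow> set_to_zero A p = p"
  unfolding set_to_zero_def by (subst mpoly_subst_cong[of _ V _ Var]) auto

text \<open>
  Divisibility in the ring of polynomials in arbitrary variables suffices: setting the variables
  outside \<open>V\<close> to zero fixes \<open>p\<close> and \<open>a\<close> and moves a cofactor into \<open>polys V\<close>.
\<close>

lemma PIdl_iff_dvd: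
  assumes "a \<in> polys V"
  shows "p \<in> PIdl\<^bsub>mpoly_ring V\<^esub> a \<longleftrightarrow> p \<in> polys V \<and> a dvd p"
proof
  assume "p \<in> PIdl\<^bsub>mpoly_ring V\<^esub> a"
  then show "p \<in> polys V \<and> a dvd p"
    using assms by (auto simp: cgenideal_def)
next
  assume p: "p \<in> polys V \<and> a dvd p"
  then obtain b where b: "p = a * b" by (auto simp: dvd_def)
  have "set_to_zero (- V) p = set_to_zero (- V) a * set_to_zero (- V) b"
    by (simp add: b set_to_zero_def)
  then have "p = set_to_zero (- V) b * a"
    using p assms by (simp add: set_to_zero_eq[of _ V] mult.commute)
  then show "p \<in> PIdl\<^bsub>mpoly_ring V\<^esub> a"
    using set_to_zero_in_polys[of b UNIV V] by (auto simp: cgenideal_def)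
qed

section \<open>Derivations and their coefficients\<close>

lemma partial_deriv_add: "partial_deriv v (p + q) = partial_deriv v p + partial_deriv v q"
  unfolding partial_deriv_def
  by (rule setsum_keys_plus_distrib) (auto simp: ring_distribs single_add)

lemma partial_deriv_diff: "partial_deriv v (p - q) = partial_deriv v p - partial_deriv v q"
  using partial_deriv_add[of v "p - q" q] by simp

lemma partial_deriv_Var: "partial_deriv v (Var u :: ('v, 'k::field) mpoly) = (if u = v then 1 else 0)"
proof -
  have "keys (Var u :: ('v, 'k) mpoly) = {Poly_Mapping.single u 1}" by (simp add: Var_def)
  then show ?thesis
    by (simp add: partial_deriv_def Var_def lookup_single when_def)
qed

lemma derivation_Var:
  assumes "u \<in> {1..l}"
  shows "derivation l f (Var u) = f u"
  using assms by (simp add: derivation_def S_ring_def partial_deriv_Var if_distrib cong: if_cong)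

lemma derivation_Var_diff:
  assumes "u \<in> {1..l}" "v \<in> {1..l}"
  shows "derivation l f (Var u - Var v) = f u - f v"
proof -
  have "derivation l f (Var u - Var v) = derivation l f (Var u) - derivation l f (Var v)"
    using assms
    by (simp add: derivation_def S_ring_def polys_diff partial_deriv_diff right_diff_distrib sum_subtractf)
  then show ?thesis using assms by (simp add: derivation_Var)
qed

lemma derivation_cong:
  "(\<And>i. i \<in> {1..l} \<Longrightarrow> f i = g i) \<Longrightarrow> derivation l f = derivation l g"
  unfolding derivation_def by (intro restrict_ext sum.cong) auto

lemma D_R_add:
  "derivation l f \<oplus>\<^bsub>D_R l G\<^esub> derivation l g = derivation l (\<lambda>i. f i + g i)"
  by (auto simp: D_R_def derivation_def ring_distribs sum.distrib intro!: restrict_ext)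

lemma D_R_smult: "r \<odot>\<^bsub>D_R l G\<^esub> derivation l f = derivation l (\<lambda>i. r * f i)"
  by (auto simp: D_R_def derivation_def sum_distrib_left mult.assoc intro!: restrict_ext)

lemma D_R_zero: "\<zero>\<^bsub>D_R l G\<^esub> = derivation l (\<lambda>_. 0)"
  by (auto simp: D_R_def derivation_def)

type_synonym ('a, 'k) face_poly = "('a set \<times> 'a set, 'k) mpoly"

section \<open>Components of a graph without some of its vertices\<close>

locale connected_graph = graph G for G :: "('a, 'b) pre_digraph" (structure) +
  assumes connected: "connected G"
begin

definition comps :: "'a set \<Rightarrow> 'a set set" where
  "comps T = verts ` pre_digraph.sccs (G \<restriction> (verts G - T))"

lemma carrier_graph_poset:
  "carrier (graph_poset G) = {(W, T). T \<subset> verts G \<and> W \<in> comps T}"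
  by (auto simp: graph_poset_def comps_def)

lemma arcs_ends_induce: "arcs_ends (G \<restriction> S) = arcs_ends G \<inter> S \<times> S"
  by (auto simp: arcs_ends_conv)

lemma comps_eq: "comps T = (\<lambda>u. {v. u \<rightarrow>\<^sup>*\<^bsub>G \<restriction> (verts G - T)\<^esub> v}) ` (verts G - T)"
proof -
  let ?H = "G \<restriction> (verts G - T)"
  interpret H: wf_digraph ?H by (rule wellformed_induce_subgraph)
  have "symmetric ?H"
    using sym_arcs by (auto simp: symmetric_def arcs_ends_induce sym_def)
  then have "H.scc_of u = {v. u \<rightarrow>\<^sup>*\<^bsub>?H\<^esub> v}" for u
    using symmetric_reachable by (auto simp: H.scc_of_def)
  then show ?thesis
    by (simp add: comps_def H.sccs_verts_conv_scc_of flip: H.sccs_verts_conv)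
qed

lemma comps_subset: "C \<in> comps T \<Longrightarrow> C \<subseteq> verts G - T"
  unfolding comps_eq by (auto elim!: reachable_in_vertsE)

lemma comps_nonempty: assumes "C \<in> comps T" shows "C \<noteq> {}"
proof -
  interpret H: wf_digraph "G \<restriction> (verts G - T)" by (rule wellformed_induce_subgraph)
  obtain u where "u \<in> verts G - T" "C = {v. u \<rightarrow>\<^sup>*\<^bsub>G \<restriction> (verts G - T)\<^esub> v}"
    using assms by (auto simp: comps_eq)
  then have "u \<in> C" using H.reachable_refl[of u] by simp
  then show ?thesis by blast
qed

lemma comps_cover:
  assumes "v \<in> verts G" "v \<notin> T" obtains C where "C \<in> comps T" "v \<in> C"
proof -
  interpret H: wf_digraph "G \<restriction> (verts G - T)" by (rule wellformed_induce_subgraph)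
  show thesis
    using that[of "{w. v \<rightarrow>\<^sup>*\<^bsub>G \<restriction> (verts G - T)\<^esub> w}"] assms by (auto simp: comps_eq)
qed

lemma comps_disjoint: "C \<in> comps T \<Longrightarrow> D \<in> comps T \<Longrightarrow> v \<in> C \<Longrightarrow> v \<in> D \<Longrightarrow> C = D"
proof -
  interpret H: wf_digraph "G \<restriction> (verts G - T)" by (rule wellformed_induce_subgraph)
  show "C \<in> comps T \<Longrightarrow> D \<in> comps T \<Longrightarrow> v \<in> C \<Longrightarrow> v \<in> D \<Longrightarrow> C = D"
    unfolding comps_def H.sccs_verts_conv[symmetric] using H.sccs_verts_disjoint by blast
qed

text \<open>
  A path inside the component joins any two of its vertices, and \<open>f\<close> does not change along an edge.
\<close>

lemma constant_on_comps:
  assumes "C \<in> comps T" "u \<in> C" "v \<in> C"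
    and f: "\<And>u v. (u, v) \<in> arcs_ends G \<Longrightarrow> u \<notin> T \<Longrightarrow> v \<notin> T \<Longrightarrow> f u = f v"
  shows "f u = f v"
proof -
  let ?H = "G \<restriction> (verts G - T)"
  obtain w where C: "C = {v. w \<rightarrow>\<^sup>*\<^bsub>?H\<^esub> v}"
    using assms(1) by (auto simp: comps_eq)
  have "f w = f x" if "w \<rightarrow>\<^sup>*\<^bsub>?H\<^esub> x" for x
    using that unfolding reachable_def
    by (induction rule: rtrancl_on_induct) (auto simp: arcs_ends_induce f)
  then show ?thesis
    using assms(2,3) C by (metis mem_Collect_eq)
qed

lemma comps_adjacent:
  assumes "C \<in> comps T" "u \<in> C" "(u, v) \<in> arcs_ends G" "v \<notin> T"
  shows "v \<in> C"
proof -
  interpret H: wf_digraph "G \<restriction> (verts G - T)" by (rule wellformed_induce_subgraph)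
  have "u \<notin> T" using assms comps_subset by blast
  then have "u \<rightarrow>\<^bsub>G \<restriction> (verts G - T)\<^esub> v"
    using assms adj_in_verts[of u v] by (auto simp: arcs_ends_induce)
  moreover obtain w where "C = {v. w \<rightarrow>\<^sup>*\<^bsub>G \<restriction> (verts G - T)\<^esub> v}"
    using assms(1) by (auto simp: comps_eq)
  ultimately show ?thesis
    using assms(2) H.reachable_adj_trans[of w u v] by simp
qed

text \<open>
  Membership in \<open>C\<close> is constant along the edges that avoid \<open>T\<close>, hence along those that avoid \<open>U\<close>, and
  therefore constant on \<open>E\<close>.
\<close>

lemma comps_refine:
  assumes "T \<subseteq> U" "C \<in> comps T" "E \<in> comps U" "v \<in> C" "v \<in> E"
  shows "E \<subseteq> C"
proof
  fix w assume w: "w \<in> E"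
  have "(v \<in> C) = (w \<in> C)"
  proof (rule constant_on_comps[OF assms(3,5) w])
    fix x y assume xy: "(x, y) \<in> arcs_ends G" "x \<notin> U" "y \<notin> U"
    have "(y, x) \<in> arcs_ends G" by (rule arcs_ends_symmetric[OF sym_arcs xy(1)])
    with xy show "(x \<in> C) = (y \<in> C)"
      using comps_adjacent[OF assms(2)] assms(1) by blast
  qed
  with assms show "w \<in> C" by blast
qed

lemma comps_empty: "comps {} = {verts G}"
proof -
  have ne: "verts G \<noteq> {}"
    using connected by (auto simp: connected_def strongly_connected_def)
  have r: "u \<rightarrow>\<^sup>* v" if "u \<in> verts G" "v \<in> verts G" for u v
  proof -
    have "u \<rightarrow>\<^sup>*\<^bsub>with_proj (mk_symmetric G)\<^esub> v"
      using connected that unfolding connected_def strongly_connected_def by auto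
    then show ?thesis using reachable_mk_symmetric_eq[OF sym_arcs] by simp
  qed
  have "arcs_ends G \<inter> verts G \<times> verts G = arcs_ends G"
    using adj_in_verts by auto
  then have "u \<rightarrow>\<^sup>*\<^bsub>G \<restriction> verts G\<^esub> v \<longleftrightarrow> u \<rightarrow>\<^sup>* v" for u v
    by (simp add: reachable_def arcs_ends_induce)
  then have "{v. u \<rightarrow>\<^sup>*\<^bsub>G \<restriction> verts G\<^esub> v} = verts G" if "u \<in> verts G" for u
    using r[OF that] by (auto elim: reachable_in_vertsE)
  then show ?thesis using ne by (auto simp: comps_eq)
qed

lemma finite_comps: "finite (comps T)"
  by (rule finite_subset[of _ "Pow (verts G)"]) (use comps_subset in blast, simp)

section \<open>The order of the poset\<close>

abbreviation P :: "('a set \<times> 'a set) gorder" where "P \<equiv> graph_poset G"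

lemma le_graph_poset [simp]: "(W, T) \<sqsubseteq>\<^bsub>P\<^esub> (W', T') \<longleftrightarrow> W' \<subseteq> W \<and> T \<subseteq> T'"
  by (simp add: graph_poset_def)

lemma bottom_graph_poset: "\<bottom>\<^bsub>P\<^esub> = (verts G, {})"
proof -
  have "verts G \<noteq> {}" using comps_empty comps_nonempty by blast
  then have bot: "least P (verts G, {}) (carrier P)"
    using comps_subset by (auto simp: least_def carrier_graph_poset comps_empty)
  have "\<bottom>\<^bsub>P\<^esub> = (SOME x. least P x (carrier P))" by (simp add: bottom_def)
  moreover have "x = (verts G, {})" if "least P x (carrier P)" for x
  proof -
    have "(verts G, {}) \<sqsubseteq>\<^bsub>P\<^esub> x" "x \<sqsubseteq>\<^bsub>P\<^esub> (verts G, {})"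
      using bot that by (auto simp: least_def)
    then show ?thesis by (cases x) auto
  qed
  ultimately show ?thesis using bot by (metis someI)
qed

lemma Upper_graph_poset:
  assumes "(C, T) \<in> carrier P" "(D, U) \<in> carrier P"
  shows "Upper P {(C, T), (D, U)} = {(E, V). (E, V) \<in> carrier P \<and> E \<subseteq> C \<inter> D \<and> T \<union> U \<subseteq> V}"
proof -
  have "Upper P {s, t} = {r \<in> carrier P. s \<sqsubseteq>\<^bsub>P\<^esub> r \<and> t \<sqsubseteq>\<^bsub>P\<^esub> r}"
    if "s \<in> carrier P" "t \<in> carrier P" for s t
    unfolding Upper_def using that by blast
  from this[OF assms] show ?thesis by auto
qed

lemma union_psubset:
  assumes "(C, T) \<in> carrier P" "(D, U) \<in> carrier P" "C \<inter> D \<noteq> {}"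
  shows "T \<union> U \<subset> verts G"
proof -
  obtain v where "v \<in> C" "v \<in> D" using assms by blast
  moreover have "C \<subseteq> verts G - T" "D \<subseteq> verts G - U"
    using assms comps_subset by (auto simp: carrier_graph_poset)
  ultimately show ?thesis using assms by (auto simp: carrier_graph_poset)
qed

text \<open>
  An upper bound \<open>(E, V)\<close> lies above \<open>(E', T \<union> U)\<close> for the component \<open>E'\<close> of \<open>G - (T \<union> U)\<close> that meets
  \<open>E\<close>, and \<open>E'\<close> stays inside \<open>C\<close> and \<open>D\<close> because deleting more vertices refines the components.
\<close>

lemma minimal_upper_bounds_graph_poset:
  assumes CT: "(C, T) \<in> carrier P" and DU: "(D, U) \<in> carrier P" and ne: "C \<inter> D \<noteq> {}"
  shows "minimal_upper_bounds P (C, T) (D, U) = {E \<in> comps (T \<union> U). E \<subseteq> C \<inter> D} \<times> {T \<union> U}"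
proof -
  have C: "C \<in> comps T" and D: "D \<in> comps U"
    using assms by (auto simp: carrier_graph_poset)
  have psub: "T \<union> U \<subset> verts G" by (rule union_psubset[OF assms])
  have upper: "(E, V) \<in> Upper P {(C, T), (D, U)} \<longleftrightarrow>
      V \<subset> verts G \<and> E \<in> comps V \<and> E \<subseteq> C \<inter> D \<and> T \<union> U \<subseteq> V" for E V
    by (auto simp: Upper_graph_poset[OF CT DU] carrier_graph_poset)
  have below: "\<exists>E'. E' \<in> comps (T \<union> U) \<and> E' \<subseteq> C \<inter> D \<and> E \<subseteq> E'"
    if V: "(E, V) \<in> Upper P {(C, T), (D, U)}" for E V
  proof -
    have EV: "V \<subset> verts G" "E \<in> comps V" "E \<subseteq> C \<inter> D" "T \<union> U \<subseteq> V"
      using V upper by auto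
    obtain v where v: "v \<in> E" using comps_nonempty[OF EV(2)] by blast
    then have "v \<in> verts G" "v \<notin> T \<union> U" using comps_subset[OF EV(2)] EV by auto
    then obtain E' where E': "E' \<in> comps (T \<union> U)" "v \<in> E'" by (rule comps_cover)
    have "E' \<subseteq> C" using comps_refine[OF _ C E'(1)] v EV E'(2) by blast
    moreover have "E' \<subseteq> D" using comps_refine[OF _ D E'(1)] v EV E'(2) by blast
    moreover have "E \<subseteq> E'" using comps_refine[OF EV(4) E'(1) EV(2)] v E' by blast
    ultimately show ?thesis using E' by blast
  qed
  show ?thesis
  proof (intro Set.set_eqI iffI)
    fix x assume x: "x \<in> minimal_upper_bounds P (C, T) (D, U)"
    obtain E V where [simp]: "x = (E, V)" by (cases x)
    have EV: "(E, V) \<in> Upper P {(C, T), (D, U)}"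
      using x by (simp add: minimal_upper_bounds_def)
    from below[OF EV] obtain E'
      where E': "E' \<in> comps (T \<union> U)" "E' \<subseteq> C \<inter> D" "E \<subseteq> E'"
      by (elim exE conjE)
    have "(E', T \<union> U) \<in> Upper P {(C, T), (D, U)}"
      unfolding upper using E' psub by blast
    moreover have "(E', T \<union> U) \<sqsubseteq>\<^bsub>P\<^esub> (E, V)"
      using E' EV upper by simp
    moreover have "\<And>r. r \<in> Upper P {(C, T), (D, U)} \<Longrightarrow> r \<sqsubseteq>\<^bsub>P\<^esub> (E, V) \<Longrightarrow> r = (E, V)"
      using x by (simp add: minimal_upper_bounds_def)
    ultimately have "(E', T \<union> U) = (E, V)" by blast
    then show "x \<in> {E \<in> comps (T \<union> U). E \<subseteq> C \<inter> D} \<times> {T \<union> U}"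
      using E' by simp
  next
    fix x assume x: "x \<in> {E \<in> comps (T \<union> U). E \<subseteq> C \<inter> D} \<times> {T \<union> U}"
    then obtain E where [simp]: "x = (E, T \<union> U)" and E: "E \<in> comps (T \<union> U)" "E \<subseteq> C \<inter> D"
      by auto
    have "(E', V) = (E, T \<union> U)"
      if EV: "(E', V) \<in> Upper P {(C, T), (D, U)}" and le: "(E', V) \<sqsubseteq>\<^bsub>P\<^esub> (E, T \<union> U)" for E' V
    proof -
      have V: "V = T \<union> U" "E \<subseteq> E'" "E' \<in> comps V" using EV le upper by auto
      moreover obtain v where "v \<in> E" using comps_nonempty[OF E(1)] by blast
      ultimately have "E' = E" using comps_disjoint E(1) by blast
      with V show ?thesis by simp
    qed
    then have "\<forall>r\<in>Upper P {(C, T), (D, U)}. r \<sqsubseteq>\<^bsub>P\<^esub> (E, T \<union> U) \<longrightarrow> r = (E, T \<union> U)"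
      by (metis surj_pair)
    moreover have "(E, T \<union> U) \<in> Upper P {(C, T), (D, U)}"
      unfolding upper using E psub by blast
    ultimately show "x \<in> minimal_upper_bounds P (C, T) (D, U)"
      by (simp add: minimal_upper_bounds_def)
  qed
qed

text \<open>
  Through a vertex \<open>v \<in> C \<inter> D\<close> there is the upper bound \<open>(E, T \<union> U)\<close>, where \<open>E\<close> is the component of
  \<open>v\<close>; conversely the first entry of an upper bound is a nonempty subset of \<open>C \<inter> D\<close>.
\<close>

lemma Upper_empty_iff:
  assumes CT: "(C, T) \<in> carrier P" and DU: "(D, U) \<in> carrier P"
  shows "Upper P {(C, T), (D, U)} = {} \<longleftrightarrow> C \<inter> D = {}"
proof
  assume "C \<inter> D = {}"
  then show "Upper P {(C, T), (D, U)} = {}"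
    using comps_nonempty by (auto simp: Upper_graph_poset[OF assms] carrier_graph_poset)
next
  assume *: "Upper P {(C, T), (D, U)} = {}"
  show "C \<inter> D = {}"
  proof (rule ccontr)
    assume ne: "C \<inter> D \<noteq> {}"
    then obtain v where v: "v \<in> C" "v \<in> D" by blast
    have CD: "C \<in> comps T" "D \<in> comps U" using assms by (auto simp: carrier_graph_poset)
    then have "v \<in> verts G" "v \<notin> T \<union> U" using v comps_subset by blast+
    then obtain E where E: "E \<in> comps (T \<union> U)" "v \<in> E" by (rule comps_cover)
    have "E \<subseteq> C" using comps_refine[OF _ CD(1) E(1)] v E(2) by blast
    moreover have "E \<subseteq> D" using comps_refine[OF _ CD(2) E(1)] v E(2) by blast
    ultimately have "(E, T \<union> U) \<in> Upper P {(C, T), (D, U)}"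
      using E union_psubset[OF assms ne] by (simp add: Upper_graph_poset[OF assms] carrier_graph_poset)
    with * show False by simp
  qed
qed

text \<open>
  Any lower bound \<open>(A, B)\<close> has \<open>B \<subseteq> T \<inter> U\<close> and \<open>v \<in> A\<close>, so its component \<open>A\<close> contains the component
  \<open>F\<close> of \<open>v\<close> in \<open>G - (T \<inter> U)\<close>.
\<close>

lemma meet_graph_poset:
  assumes CT: "(C, T) \<in> carrier P" and DU: "(D, U) \<in> carrier P"
    and v: "v \<in> C" "v \<in> D" and F: "F \<in> comps (T \<inter> U)" "v \<in> F"
  shows "(C, T) \<sqinter>\<^bsub>P\<^esub> (D, U) = (F, T \<inter> U)"
proof -
  have CD: "C \<in> comps T" "D \<in> comps U" "T \<subset> verts G"
    using assms by (auto simp: carrier_graph_poset)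
  have lower: "Lower P {(C, T), (D, U)} = {(A, B). (A, B) \<in> carrier P \<and> C \<union> D \<subseteq> A \<and> B \<subseteq> T \<inter> U}"
  proof -
    have "Lower P {s, t} = {r \<in> carrier P. r \<sqsubseteq>\<^bsub>P\<^esub> s \<and> r \<sqsubseteq>\<^bsub>P\<^esub> t}"
      if "s \<in> carrier P" "t \<in> carrier P" for s t
      unfolding Lower_def using that by blast
    from this[OF CT DU] show ?thesis by auto
  qed
  have "C \<subseteq> F" using comps_refine[OF _ F(1) CD(1)] v F(2) by blast
  moreover have "D \<subseteq> F" using comps_refine[OF _ F(1) CD(2)] v F(2) by blast
  ultimately have low: "(F, T \<inter> U) \<in> Lower P {(C, T), (D, U)}"
    using F CD(3) by (auto simp: lower carrier_graph_poset)
  have great: "F \<subseteq> A \<and> B \<subseteq> T \<inter> U" if "(A, B) \<in> Lower P {(C, T), (D, U)}" for A B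
  proof -
    have AB: "A \<in> comps B" "C \<subseteq> A" "B \<subseteq> T \<inter> U" using that by (auto simp: lower carrier_graph_poset)
    then have "F \<subseteq> A" using comps_refine[OF AB(3,1) F(1)] v F(2) by blast
    with AB show ?thesis by blast
  qed
  have gr: "greatest P (F, T \<inter> U) (Lower P {(C, T), (D, U)})"
    unfolding greatest_def
  proof (intro conjI ballI low)
    show "Lower P {(C, T), (D, U)} \<subseteq> carrier P" by (auto simp: lower)
    show "x \<sqsubseteq>\<^bsub>P\<^esub> (F, T \<inter> U)" if "x \<in> Lower P {(C, T), (D, U)}" for x
      using great that by (cases x) simp
  qed
  have "x = (F, T \<inter> U)" if "greatest P x (Lower P {(C, T), (D, U)})" for x
  proof -
    have "(F, T \<inter> U) \<sqsubseteq>\<^bsub>P\<^esub> x" "x \<sqsubseteq>\<^bsub>P\<^esub> (F, T \<inter> U)"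
      using gr that by (auto simp: greatest_def)
    then show ?thesis by (cases x) auto
  qed
  with gr show ?thesis
    unfolding meet_def Lattice.inf_def by (metis (no_types, lifting) someI)
qed

lemma finite_psubset_verts: "T \<subset> verts G \<Longrightarrow> finite T"
  by (rule finite_subset[of _ "verts G"]) auto

lemma comps_refineE:
  assumes "T \<subseteq> U" "E \<in> comps U"
  obtains F where "F \<in> comps T" "E \<subseteq> F"
proof -
  obtain v where v: "v \<in> E" using comps_nonempty[OF assms(2)] by blast
  then have "v \<in> verts G" "v \<notin> T" using comps_subset[OF assms(2)] assms(1) by auto
  then obtain F where F: "F \<in> comps T" "v \<in> F" by (rule comps_cover)
  have "E \<subseteq> F" by (rule comps_refine[OF assms(1) F(1) assms(2) F(2) v])
  then show thesis by (rule that[OF F(1)])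
qed

lemma sum_indicator_comps:
  assumes "v \<in> verts G" "v \<notin> T"
  shows "(\<Sum>W\<in>comps T. if v \<in> W then a else 0) = a"
proof -
  obtain C where C: "C \<in> comps T" "v \<in> C" using comps_cover assms by blast
  then have "(\<Sum>W\<in>comps T. if v \<in> W then a else 0) = (\<Sum>W\<in>comps T. if W = C then a else 0)"
    using comps_disjoint by (intro sum.cong) auto
  with C show ?thesis by (simp add: finite_comps)
qed

section \<open>Splines and restriction to facets\<close>

text \<open>
  The restriction of a face polynomial to the maximal face \<open>({v}, V - {v})\<close>, on which \<open>x\<^sub>v\<close> is zero,
  followed by the substitution \<open>x\<^sub>i \<mapsto> x\<^sub>i - x\<^sub>v\<close> that turns polynomials without \<open>x\<^sub>v\<close> into elements of \<open>R\<close>.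
\<close>

definition facet_restriction :: "'a \<Rightarrow> ('a set \<times> 'a set, 'k::field) mpoly \<Rightarrow> ('a, 'k) mpoly" where
  "facet_restriction v = mpoly_subst (\<lambda>(W, T). if v \<in> W then \<Prod>i\<in>T. Var i - Var v else 0)"

text \<open>
  The ring \<open>R\<close> generated by the differences of variables, described as the ring of polynomials that
  do not change when \<open>x\<^sub>v\<close> is subtracted from every variable. In this form membership can be checked
  by evaluating substitutions.
\<close>

definition difference_polys :: "('a, 'k::field) mpoly set" where
  "difference_polys = {f \<in> polys (verts G). \<forall>v\<in>verts G. mpoly_subst (\<lambda>i. Var i - Var v) f = f}"

definition spline :: "('a \<Rightarrow> ('a, 'k::field) mpoly) \<Rightarrow> bool" where
  "spline f \<longleftrightarrow> (\<forall>v\<in>verts G. f v \<in> difference_polys) \<and>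
    (\<forall>(u, v)\<in>arcs_ends G. Var u - Var v dvd f u - f v)"

lemma facet_restriction_simps [simp]:
  "facet_restriction v (p + q) = facet_restriction v p + facet_restriction v q"
  "facet_restriction v (p - q) = facet_restriction v p - facet_restriction v q"
  "facet_restriction v (- p) = - facet_restriction v p"
  "facet_restriction v (p * q) = facet_restriction v p * facet_restriction v q"
  "facet_restriction v (p ^ n) = facet_restriction v p ^ n"
  "facet_restriction v (sum h A) = (\<Sum>i\<in>A. facet_restriction v (h i))"
  "facet_restriction v (prod h A) = (\<Prod>i\<in>A. facet_restriction v (h i))"
  "facet_restriction v 0 = 0" "facet_restriction v 1 = 1" "facet_restriction v (Const c) = Const c"
  "facet_restriction v (Var (W, T)) = (if v \<in> W then \<Prod>i\<in>T. Var i - Var v else 0)"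
  by (simp_all add: facet_restriction_def)

lemma vertex_sum_eq: "{i} \<noteq> verts G \<Longrightarrow> i \<in> verts G \<Longrightarrow> vertex_sum G i = (\<Sum>W\<in>comps {i}. Var (W, {i}))"
proof -
  assume "{i} \<noteq> verts G" "i \<in> verts G"
  then have "{s \<in> carrier P. snd s = {i}} = (\<lambda>W. (W, {i})) ` comps {i}"
    by (auto simp: carrier_graph_poset)
  then show ?thesis
    by (simp add: vertex_sum_def sum.reindex inj_on_def)
qed

lemma vertex_sum_in_polys: "vertex_sum G i \<in> polys (carrier P)"
  unfolding vertex_sum_def by (intro polys_sum) auto

text \<open>
  For \<open>i \<noteq> v\<close> exactly one component of \<open>G - {i}\<close> contains \<open>v\<close>; for \<open>i = v\<close> none does, and
  \<open>x\<^sub>v - x\<^sub>v\<close> is zero as well. The two cases thus give one formula.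
\<close>

lemma facet_restriction_vertex_sum:
  assumes "i \<in> verts G" "v \<in> verts G"
  shows "facet_restriction v (vertex_sum G i) = (Var i - Var v :: ('a, 'k::field) mpoly)"
proof (cases "i = v")
  case True
  have "facet_restriction v (Var s) = (0 :: ('a, 'k) mpoly)" if "s \<in> carrier P" "snd s = {i}" for s
    using that True by (cases s) auto
  with True show ?thesis by (simp add: vertex_sum_def)
next
  case False
  with assms have "{i} \<noteq> verts G" by auto
  then have "facet_restriction v (vertex_sum G i) = (\<Sum>W\<in>comps {i}. if v \<in> W then Var i - Var v else 0)"
    using assms by (simp add: vertex_sum_eq cong: if_cong)
  also have "\<dots> = Var i - Var v"
    using False assms by (intro sum_indicator_comps) auto
  finally show ?thesis .
qed

text \<open>
  This is the reason why the isomorphism is linear over \<open>R\<close>: acting by \<open>r\<close> on the face ring becomes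
  multiplication by \<open>r\<close> in every coordinate.
\<close>

lemma facet_restriction_subst_vertex_sum:
  assumes "r \<in> difference_polys" "v \<in> verts G"
  shows "facet_restriction v (mpoly_subst (vertex_sum G) r) = r"
proof -
  have "facet_restriction v (mpoly_subst (vertex_sum G) r) = mpoly_subst (\<lambda>i. facet_restriction v (vertex_sum G i)) r"
    unfolding facet_restriction_def by (rule mpoly_subst_mpoly_subst)
  also have "\<dots> = mpoly_subst (\<lambda>i. Var i - Var v) r"
    using assms by (intro mpoly_subst_cong[of _ "verts G"])
      (auto simp: difference_polys_def facet_restriction_vertex_sum)
  finally show ?thesis using assms by (simp add: difference_polys_def)
qed

lemma facet_restriction_in_difference_polys:
  assumes p: "p \<in> polys (carrier P)" and v: "v \<in> verts G"
  shows "facet_restriction v p \<in> difference_polys"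
proof -
  have "facet_restriction v p \<in> polys (verts G)"
    unfolding facet_restriction_def using v
    by (intro mpoly_subst_in_polys[OF p]) (auto simp: carrier_graph_poset split: if_splits intro!: polys_prod polys_diff; blast)
  moreover have "mpoly_subst (\<lambda>i. Var i - Var w) (facet_restriction v p) = facet_restriction v p" for w
    unfolding facet_restriction_def mpoly_subst_mpoly_subst
    by (intro arg_cong[where f = "\<lambda>g. mpoly_subst g p"] ext) (auto split: prod.splits)
  ultimately show ?thesis by (simp add: difference_polys_def)
qed

text \<open>
  It suffices to look at the variable of \<open>(W, T)\<close>. If both ends of the edge lie in \<open>W\<close>, the two
  restrictions become equal when \<open>x\<^sub>u\<close> and \<open>x\<^sub>v\<close> are identified. If only \<open>u\<close> does, then \<open>v \<in> T\<close>, as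
  otherwise the edge would put \<open>v\<close> in the component \<open>W\<close>; so \<open>x\<^sub>v - x\<^sub>u\<close> is a factor of the restriction
  to \<open>u\<close>, and the restriction to \<open>v\<close> is zero.
\<close>

lemma spline_facet_restriction:
  fixes p :: "('a set \<times> 'a set, 'k::field) mpoly"
  assumes p: "p \<in> polys (carrier P)"
  shows "spline (\<lambda>v. facet_restriction v p)"
  unfolding spline_def
proof (intro conjI ballI facet_restriction_in_difference_polys[OF p], assumption, clarify)
  fix u v assume uv: "(u, v) \<in> arcs_ends G"
  then have vu: "(v, u) \<in> arcs_ends G" using sym_arcs by (rule arcs_ends_symmetric[rotated])
  have "(Var u - Var v :: ('a, 'k) mpoly) dvd facet_restriction u (Var s) - facet_restriction v (Var s)"
    if s: "s \<in> carrier P" for s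
  proof -
    obtain W T where [simp]: "s = (W, T)" by (cases s)
    have W: "W \<in> comps T" and T: "finite T"
      using s finite_psubset_verts by (auto simp: carrier_graph_poset)
    let ?t = "\<lambda>v. \<Prod>i\<in>T. Var i - Var v :: ('a, 'k) mpoly"
    consider "u \<in> W" "v \<in> W" | "u \<in> W" "v \<in> T" "v \<notin> W" | "v \<in> W" "u \<in> T" "u \<notin> W" | "u \<notin> W" "v \<notin> W"
      using comps_adjacent[OF W _ uv] comps_adjacent[OF W _ vu] by blast
    then show ?thesis
    proof cases
      case 1
      have "(Var u - Var v :: ('a, 'k) mpoly) dvd mpoly_subst (\<lambda>i. Var i - Var u) (prod Var T)
          - mpoly_subst (\<lambda>i. Var i - Var v) (prod Var T)"
      proof (rule dvd_mpoly_subst_diff[OF polys_UNIV])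
        have "Var i - Var u - (Var i - Var v) = - (Var u - Var v :: ('a, 'k) mpoly)" for i by simp
        then show "(Var u - Var v :: ('a, 'k) mpoly) dvd Var i - Var u - (Var i - Var v)" for i by (simp only: dvd_minus_iff dvd_refl)
      qed
      with 1 show ?thesis by simp
    next
      case 2
      have "Var v - Var u dvd ?t u" using 2 T by (intro dvd_prodI) auto
      then have "- (Var v - Var u) dvd ?t u" by (simp only: minus_dvd_iff)
      then show ?thesis using 2 by simp
    next
      case 3
      have "Var u - Var v dvd ?t v" using 3 T by (intro dvd_prodI) auto
      with 3 show ?thesis by simp
    qed simp
  qed
  then show "Var u - Var v dvd facet_restriction u p - facet_restriction v p"
    unfolding facet_restriction_def by (intro dvd_mpoly_subst_diff[OF p]) auto
qed

text \<open>
  Setting \<open>x\<^sub>v = 0\<close> keeps exactly the coefficients mentioned in the hypothesis, and the substitution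
  \<open>x\<^sub>i \<mapsto> x\<^sub>i - x\<^sub>v\<close> recovers a translation-invariant polynomial from the result.
\<close>

lemma difference_polys_eqI:
  assumes f: "f \<in> difference_polys" and g: "g \<in> difference_polys" and v: "v \<in> verts G"
    and eq: "\<And>m. v \<notin> keys m \<Longrightarrow> lookup f m = lookup g m"
  shows "f = g"
proof -
  have *: "mpoly_subst (\<lambda>i. Var i - Var v) (set_to_zero {v} h) = h" if "h \<in> difference_polys" for h
  proof -
    have "mpoly_subst (\<lambda>i. Var i - Var v) (set_to_zero {v} h) = mpoly_subst (\<lambda>i. Var i - Var v) h"
      unfolding set_to_zero_def mpoly_subst_mpoly_subst
      by (intro arg_cong[where f = "\<lambda>g. mpoly_subst g h"] ext) auto
    then show ?thesis using that v by (simp add: difference_polys_def)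
  qed
  have "set_to_zero {v} f = set_to_zero {v} g"
    by (rule poly_mapping_eqI) (auto simp: lookup_set_to_zero eq)
  then show ?thesis by (metis *[OF f] *[OF g])
qed

text \<open>
  Along an edge of \<open>G - keys m\<close>, setting \<open>x\<^sub>u = x\<^sub>v = 0\<close> sends \<open>x\<^sub>u - x\<^sub>v\<close> to zero but fixes the monomial \<open>m\<close>.
\<close>

lemma spline_lookup_eq:
  assumes f: "spline f" and C: "C \<in> comps (keys m)" "u \<in> C" "v \<in> C"
  shows "lookup (f u) m = lookup (f v) m"
proof (rule constant_on_comps[OF C])
  fix u v assume uv: "(u, v) \<in> arcs_ends G" "u \<notin> keys m" "v \<notin> keys m"
  then obtain h where "f u - f v = (Var u - Var v) * h"
    using f by (auto simp: spline_def dvd_def)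
  then have "set_to_zero {u, v} (f u - f v) = set_to_zero {u, v} ((Var u - Var v) * h)" by simp
  then have "set_to_zero {u, v} (f u) = set_to_zero {u, v} (f v)" by (simp add: set_to_zero_def)
  then have "lookup (set_to_zero {u, v} (f u)) m = lookup (set_to_zero {u, v} (f v)) m" by simp
  with uv show "lookup (f u) m = lookup (f v) m" by (simp add: lookup_set_to_zero)
qed

section \<open>The face ideal\<close>

lemma bottom_in_carrier: "(verts G, {}) \<in> carrier P"
  using comps_empty comps_nonempty by (auto simp: carrier_graph_poset)

lemma meet_graph_posetE:
  assumes "(C, T) \<in> carrier P" "(D, U) \<in> carrier P" "C \<inter> D \<noteq> {}"
  obtains F where "F \<in> comps (T \<inter> U)" "C \<union> D \<subseteq> F"
    "(C, T) \<sqinter>\<^bsub>P\<^esub> (D, U) = (F, T \<inter> U)"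
proof -
  have CD: "C \<in> comps T" "D \<in> comps U" using assms by (auto simp: carrier_graph_poset)
  obtain v where v: "v \<in> C" "v \<in> D" using assms by blast
  then have "v \<in> verts G" "v \<notin> T \<inter> U" using CD comps_subset by blast+
  then obtain F where F: "F \<in> comps (T \<inter> U)" "v \<in> F" by (rule comps_cover)
  have "C \<subseteq> F" by (rule comps_refine[OF _ F(1) CD(1) F(2) v(1)]) blast
  moreover have "D \<subseteq> F" by (rule comps_refine[OF _ F(1) CD(2) F(2) v(2)]) blast
  ultimately show thesis
    using that[OF F(1)] meet_graph_poset[OF assms(1,2) v F] by blast
qed

lemma sum_minimal_upper_bounds:
  assumes "(C, T) \<in> carrier P" "(D, U) \<in> carrier P" "C \<inter> D \<noteq> {}"
  shows "(\<Sum>r\<in>minimal_upper_bounds P (C, T) (D, U). Var r)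
    = (\<Sum>E | E \<in> comps (T \<union> U) \<and> E \<subseteq> C \<inter> D. Var (E, T \<union> U))"
proof -
  have "minimal_upper_bounds P (C, T) (D, U)
      = (\<lambda>E. (E, T \<union> U)) ` {E \<in> comps (T \<union> U). E \<subseteq> C \<inter> D}"
    unfolding minimal_upper_bounds_graph_poset[OF assms] by auto
  then show ?thesis by (simp add: sum.reindex inj_on_def)
qed

lemma face_relationE:
  assumes "r \<in> face_relations P"
  obtains "r = Var (verts G, {}) - 1"
  | C T D U where "(C, T) \<in> carrier P" "(D, U) \<in> carrier P" "C \<inter> D = {}"
      "r = Var (C, T) * Var (D, U)"
  | C T D U F where "(C, T) \<in> carrier P" "(D, U) \<in> carrier P" "C \<inter> D \<noteq> {}"
      "F \<in> comps (T \<inter> U)" "C \<union> D \<subseteq> F"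
      "r = Var (C, T) * Var (D, U)
        - Var (F, T \<inter> U) * (\<Sum>E | E \<in> comps (T \<union> U) \<and> E \<subseteq> C \<inter> D. Var (E, T \<union> U))"
proof -
  consider "r = Var (verts G, {}) - 1"
    | s t where "r = Var s * Var t" "s \<in> carrier P" "t \<in> carrier P" "Upper P {s, t} = {}"
    | s t where "r = Var s * Var t - Var (s \<sqinter>\<^bsub>P\<^esub> t) * (\<Sum>r\<in>minimal_upper_bounds P s t. Var r)"
        "s \<in> carrier P" "t \<in> carrier P" "Upper P {s, t} \<noteq> {}"
    using assms unfolding face_relations_def bottom_graph_poset by blast
  then show thesis
  proof cases
    case 1
    then show thesis by (rule that(1))
  next
    case (2 s t)
    obtain C T D U where st: "s = (C, T)" "t = (D, U)" by (metis surj_pair)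
    show thesis using that(2)[of C T D U] 2 Upper_empty_iff[of C T D U] by (simp add: st)
  next
    case (3 s t)
    obtain C T D U where st: "s = (C, T)" "t = (D, U)" by (metis surj_pair)
    have CT: "(C, T) \<in> carrier P" and DU: "(D, U) \<in> carrier P" and ne: "C \<inter> D \<noteq> {}"
      using 3 Upper_empty_iff[of C T D U] by (simp_all add: st)
    obtain F where F: "F \<in> comps (T \<inter> U)" "C \<union> D \<subseteq> F"
      "(C, T) \<sqinter>\<^bsub>P\<^esub> (D, U) = (F, T \<inter> U)"
      by (rule meet_graph_posetE[OF CT DU ne])
    show thesis
      using that(3)[OF CT DU ne F(1,2)] 3(1)
      unfolding st F(3) sum_minimal_upper_bounds[OF CT DU ne] by simp
  qed
qed

lemma face_relations_subset: "face_relations P \<subseteq> polys (carrier P)"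
proof
  fix r assume "r \<in> face_relations P"
  then show "r \<in> polys (carrier P)"
  proof (cases rule: face_relationE)
    case 1
    then show ?thesis using bottom_in_carrier by auto
  next
    case (2 C T D U)
    then show ?thesis by auto
  next
    case (3 C T D U F)
    have "(F, T \<inter> U) \<in> carrier P"
      using 3(1,2,4) by (auto simp: carrier_graph_poset)
    moreover have "(E, T \<union> U) \<in> carrier P" if "E \<in> comps (T \<union> U)" for E
      using that union_psubset[OF 3(1-3)] by (auto simp: carrier_graph_poset)
    ultimately show ?thesis
      unfolding 3(6) using 3(1,2) by (intro polys_diff polys_mult polys_sum) auto
  qed
qed

lemma ideal_face_ideal: "ideal (face_ideal P) (mpoly_ring (carrier P))"
  unfolding face_ideal_def
  by (rule ring.genideal_ideal[OF cring.axioms(1)[OF cring_mpoly_ring] face_relations_subset])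

lemma face_relations_in_face_ideal: "face_relations P \<subseteq> face_ideal P"
  unfolding face_ideal_def
  by (rule ring.genideal_self[OF cring.axioms(1)[OF cring_mpoly_ring] face_relations_subset])

text \<open>
  Only the third kind of relation needs an argument, and only for \<open>v \<in> C \<inter> D\<close>. Then exactly one of
  the minimal upper bounds has \<open>v\<close> in its first entry, and the claim becomes
  \<open>\<Prod>T \<cdot> \<Prod>U = \<Prod>(T \<inter> U) \<cdot> \<Prod>(T \<union> U)\<close>.
\<close>

lemma facet_restriction_face_relation:
  fixes r :: "('a set \<times> 'a set, 'k::field) mpoly"
  assumes r: "r \<in> face_relations P" and v: "v \<in> verts G"
  shows "facet_restriction v r = 0"
  using r
proof (cases rule: face_relationE)
  case 1
  then show ?thesis using v by simp
next
  case (2 C T D U)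
  then show ?thesis by auto
next
  case (3 C T D U F)
  let ?t = "\<lambda>T. \<Prod>i\<in>T. Var i - Var v :: ('a, 'k) mpoly"
  let ?S = "\<Sum>E | E \<in> comps (T \<union> U) \<and> E \<subseteq> C \<inter> D. if v \<in> E then ?t (T \<union> U) else 0"
  have CD: "C \<in> comps T" "D \<in> comps U" and fin: "finite T" "finite U"
    using 3(1,2) finite_psubset_verts by (auto simp: carrier_graph_poset)
  show ?thesis
  proof (cases "v \<in> C \<inter> D")
    case True
    then have vTU: "v \<notin> T \<union> U" using CD comps_subset by blast
    have sub: "E \<subseteq> C \<inter> D" if E: "E \<in> comps (T \<union> U)" "v \<in> E" for E
    proof -
      have "E \<subseteq> C" by (rule comps_refine[OF _ CD(1) E(1) _ E(2)]) (use True in auto)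
      moreover have "E \<subseteq> D" by (rule comps_refine[OF _ CD(2) E(1) _ E(2)]) (use True in auto)
      ultimately show ?thesis by blast
    qed
    have "?S = (\<Sum>E\<in>comps (T \<union> U). if v \<in> E then ?t (T \<union> U) else 0)"
      by (rule sum.mono_neutral_left) (use finite_comps sub in auto)
    also have "\<dots> = ?t (T \<union> U)"
      by (rule sum_indicator_comps[OF v vTU])
    finally have "?S = ?t (T \<union> U)" .
    moreover have "?t (T \<inter> U) * ?t (T \<union> U) = ?t T * ?t U"
      using prod.union_inter[OF fin] by (simp add: mult.commute)
    moreover have "v \<in> C" "v \<in> D" "v \<in> F" using True 3(5) by auto
    ultimately show ?thesis unfolding 3(6) by simp
  next
    case False
    then have "?S = 0" by (intro sum.neutral) auto
    then show ?thesis unfolding 3(6) using False by auto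
  qed
qed

lemma facet_restriction_face_ideal:
  assumes p: "p \<in> face_ideal P" and v: "v \<in> verts G"
  shows "facet_restriction v p = 0"
proof -
  let ?R = "mpoly_ring (carrier P)" and ?K = "{p \<in> polys (carrier P). facet_restriction v p = 0}"
  interpret cring ?R by (rule cring_mpoly_ring)
  have "ideal ?K ?R"
  proof (rule idealI)
    show "subgroup ?K (add_monoid ?R)"
    proof (rule subgroup.intro)
      fix x assume "x \<in> ?K"
      then show "inv\<^bsub>add_monoid ?R\<^esub> x \<in> ?K"
        unfolding a_inv_def[symmetric] by (auto simp: mpoly_ring_a_inv)
    qed auto
  qed (use ring_axioms in auto)
  then have "face_ideal P \<subseteq> ?K"
    unfolding face_ideal_def
    by (rule genideal_minimal) (use face_relations_subset facet_restriction_face_relation[OF _ v] in auto)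
  with p show ?thesis by auto
qed

section \<open>Products of face variables\<close>

definition face_cong :: "('a set \<times> 'a set, 'k::field) mpoly \<Rightarrow> ('a set \<times> 'a set, 'k) mpoly \<Rightarrow> bool"
    (infix \<open>\<approx>\<close> 50) where
  "p \<approx> q \<longleftrightarrow> p - q \<in> face_ideal P"

lemma face_ideal_zero: "0 \<in> face_ideal P"
  using additive_subgroup.zero_closed[OF ideal.axioms(1)[OF ideal_face_ideal]] by simp

lemma face_ideal_add: "p \<in> face_ideal P \<Longrightarrow> q \<in> face_ideal P \<Longrightarrow> p + q \<in> face_ideal P"
  using additive_subgroup.a_closed[OF ideal.axioms(1)[OF ideal_face_ideal]] by simp

lemma face_ideal_mult: "p \<in> polys (carrier P) \<Longrightarrow> q \<in> face_ideal P \<Longrightarrow> p * q \<in> face_ideal P"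
  using ideal.I_l_closed[OF ideal_face_ideal] by simp

lemma face_ideal_uminus: "p \<in> face_ideal P \<Longrightarrow> - p \<in> face_ideal P"
  using face_ideal_mult[of "- 1" p] by auto

lemma face_cong_refl [simp, intro]: "p \<approx> p"
  by (simp add: face_cong_def face_ideal_zero)

lemma face_cong_sym: "p \<approx> q \<Longrightarrow> q \<approx> p"
  unfolding face_cong_def using face_ideal_uminus[of "p - q"] by simp

lemma face_cong_trans [trans]: "p \<approx> q \<Longrightarrow> q \<approx> r \<Longrightarrow> p \<approx> r"
  unfolding face_cong_def using face_ideal_add[of "p - q" "q - r"] by simp

lemma face_cong_add: "p \<approx> q \<Longrightarrow> p' \<approx> q' \<Longrightarrow> p + p' \<approx> q + q'"
  unfolding face_cong_def using face_ideal_add[of "p - q" "p' - q'"] by (simp add: algebra_simps)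

lemma face_cong_mult: "r \<in> polys (carrier P) \<Longrightarrow> p \<approx> q \<Longrightarrow> r * p \<approx> r * q"
  unfolding face_cong_def using face_ideal_mult[of r "p - q"] by (simp add: algebra_simps)

lemma face_cong_sum: "(\<And>i. i \<in> A \<Longrightarrow> f i \<approx> g i) \<Longrightarrow> sum f A \<approx> sum g A"
  by (induction A rule: infinite_finite_induct) (auto intro: face_cong_add)

lemma Var_bottom_cong: "Var (verts G, {}) \<approx> 1"
  unfolding face_cong_def using face_relations_in_face_ideal
  by (auto simp: face_relations_def bottom_graph_poset)

lemma Var_mult_disjoint_cong:
  assumes "(C, T) \<in> carrier P" "(D, U) \<in> carrier P" "C \<inter> D = {}"
  shows "Var (C, T) * Var (D, U) \<approx> 0"
proof -
  have "Var (C, T) * Var (D, U) \<in> face_relations P"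
    unfolding face_relations_def using assms Upper_empty_iff[OF assms(1,2)] by blast
  then show ?thesis unfolding face_cong_def using face_relations_in_face_ideal by auto
qed

lemma Var_mult_meet_cong:
  assumes "(C, T) \<in> carrier P" "(D, U) \<in> carrier P" "C \<inter> D \<noteq> {}"
  obtains F where "F \<in> comps (T \<inter> U)" "C \<union> D \<subseteq> F"
    "Var (C, T) * Var (D, U)
      \<approx> Var (F, T \<inter> U) * (\<Sum>E | E \<in> comps (T \<union> U) \<and> E \<subseteq> C \<inter> D. Var (E, T \<union> U))"
proof -
  obtain F where F: "F \<in> comps (T \<inter> U)" "C \<union> D \<subseteq> F"
    "(C, T) \<sqinter>\<^bsub>P\<^esub> (D, U) = (F, T \<inter> U)"
    by (rule meet_graph_posetE[OF assms])
  have "Var (C, T) * Var (D, U) - Var ((C, T) \<sqinter>\<^bsub>P\<^esub> (D, U))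
      * (\<Sum>r\<in>minimal_upper_bounds P (C, T) (D, U). Var r) \<in> face_relations P"
    unfolding face_relations_def using assms Upper_empty_iff[OF assms(1,2)] by blast
  then show thesis
    using that[OF F(1,2)] face_relations_in_face_ideal
    unfolding face_cong_def F(3) sum_minimal_upper_bounds[OF assms] by blast
qed

text \<open>
  Distinct components of \<open>G - T\<close> are disjoint, so only the component that contains \<open>E\<close> has a common
  upper bound with \<open>(E, V)\<close>; the other products vanish.
\<close>

lemma sum_comps_mult_cong:
  assumes EV: "(E, V) \<in> carrier P" and T: "T \<subseteq> V"
    and A: "A \<subseteq> comps T" "F \<in> A" "E \<subseteq> F"
  shows "(\<Sum>C\<in>A. Var (C, T)) * Var (E, V) \<approx> Var (F, T) * Var (E, V)"
proof -
  have V: "V \<subset> verts G" "E \<in> comps V" using EV by (auto simp: carrier_graph_poset)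
  have fin: "finite A" using A(1) finite_comps by (rule finite_subset)
  have "Var (C, T) * Var (E, V) \<approx> 0" if C: "C \<in> A - {F}" for C
  proof (rule Var_mult_disjoint_cong[OF _ EV])
    show "(C, T) \<in> carrier P" using C A T V by (auto simp: carrier_graph_poset)
    have "F \<in> comps T" "C \<in> comps T" "C \<noteq> F" using C A by auto
    then show "C \<inter> E = {}" using comps_disjoint A(3) by blast
  qed
  then have "(\<Sum>C\<in>A - {F}. Var (C, T) * Var (E, V)) \<approx> (\<Sum>C\<in>A - {F}. 0)"
    by (rule face_cong_sum)
  then have "Var (F, T) * Var (E, V) + (\<Sum>C\<in>A - {F}. Var (C, T) * Var (E, V))
      \<approx> Var (F, T) * Var (E, V) + 0"
    by (intro face_cong_add) auto
  then show ?thesis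
    by (simp add: sum.remove[OF fin A(2)] distrib_right sum_distrib_right)
qed

text \<open>
  Below \<open>(E, V)\<close> the variable of \<open>(F, M)\<close> behaves like the product of its atoms. To add \<open>i\<close> to \<open>M\<close>,
  multiply the variables of the components \<open>F'\<close> of \<open>G - M\<close> and \<open>W\<close> of \<open>G - {i}\<close> that contain \<open>F\<close>:
  their meet is the least element, whose variable is \<open>1\<close>, and among their minimal upper bounds only
  \<open>(F, insert i M)\<close> survives the multiplication by the variable of \<open>(E, V)\<close>.
\<close>

lemma Var_mult_above_cong:
  assumes EV: "(E, V) \<in> carrier P"
    and M: "finite M" "M \<subseteq> V" "F \<in> comps M" "E \<subseteq> F"
  shows "Var (F, M) * Var (E, V) \<approx> (\<Prod>i\<in>M. vertex_sum G i) * (Var (E, V) :: ('a, 'k::field) face_poly)"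
  using M
proof (induction M arbitrary: F rule: finite_induct)
  case empty
  have "Var (E, V) * Var (verts G, {}) \<approx> (Var (E, V) * 1 :: ('a, 'k) face_poly)"
    by (rule face_cong_mult[OF _ Var_bottom_cong]) (use EV in simp)
  with empty show ?case by (simp add: comps_empty mult.commute)
next
  case (insert i M F)
  let ?X = "Var (E, V) :: ('a, 'k) face_poly"
  have V: "V \<subset> verts G" "E \<in> comps V" using EV by (auto simp: carrier_graph_poset)
  obtain F' where F': "F' \<in> comps M" "F \<subseteq> F'"
    using comps_refineE[OF _ insert.prems(2)] by blast
  obtain W where W: "W \<in> comps {i}" "F \<subseteq> W"
    using comps_refineE[OF _ insert.prems(2), of "{i}"] by blast
  have carr: "(F', M) \<in> carrier P" "(W, {i}) \<in> carrier P"
    using F' W V insert.prems(1) by (auto simp: carrier_graph_poset)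
  have ne: "F' \<inter> W \<noteq> {}"
    using comps_nonempty[OF insert.prems(2)] F' W by blast
  let ?S = "\<Sum>C | C \<in> comps (M \<union> {i}) \<and> C \<subseteq> F' \<inter> W. Var (C, M \<union> {i}) :: ('a, 'k) face_poly"
  have S: "?S \<in> polys (carrier P)"
    using union_psubset[OF carr ne] by (intro polys_sum) (auto simp: carrier_graph_poset)
  have i: "{i} \<noteq> verts G" "i \<in> verts G" using V insert.prems(1) by auto
  have "vertex_sum G i * ?X \<approx> Var (W, {i}) * ?X"
    unfolding vertex_sum_eq[OF i]
    by (rule sum_comps_mult_cong[OF EV]) (use insert.prems W in auto)
  from face_cong_mult[OF _ face_cong_sym[OF this]]
  have atom: "Var (F', M) * (Var (W, {i}) * ?X) \<approx> Var (F', M) * (vertex_sum G i * ?X)"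
    using carr by simp
  obtain F0 where F0: "F0 \<in> comps (M \<inter> {i})"
      "Var (F', M) * Var (W, {i}) \<approx> Var (F0, M \<inter> {i}) * ?S"
    by (rule Var_mult_meet_cong[OF carr ne])
  have "M \<inter> {i} = {}" using insert.hyps by auto
  with F0 have "Var (F', M) * Var (W, {i}) \<approx> ?S * Var (verts G, {})"
    by (simp add: comps_empty mult.commute)
  also have "\<dots> \<approx> ?S * 1"
    by (rule face_cong_mult[OF S Var_bottom_cong])
  finally have "Var (F', M) * Var (W, {i}) \<approx> ?S" by simp
  from face_cong_mult[OF _ face_cong_sym[OF this]]
  have prod: "?X * ?S \<approx> ?X * (Var (F', M) * Var (W, {i}))"
    using EV by simp
  have "?S * ?X \<approx> Var (F, M \<union> {i}) * ?X"
    by (rule sum_comps_mult_cong[OF EV]) (use insert.prems F' W in auto)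
  note sum = face_cong_sym[OF this]
  have "Var (F, insert i M) * ?X = Var (F, M \<union> {i}) * ?X" by simp
  also note sum
  also have "?S * ?X = ?X * ?S" by (rule mult.commute)
  also note prod
  also have "?X * (Var (F', M) * Var (W, {i})) = Var (F', M) * (Var (W, {i}) * ?X)"
    by (simp only: mult_ac)
  also note atom
  also have "Var (F', M) * (vertex_sum G i * ?X) = vertex_sum G i * (Var (F', M) * ?X)"
    by (simp only: mult_ac)
  also have "\<dots> \<approx> vertex_sum G i * ((\<Prod>i\<in>M. vertex_sum G i) * ?X)"
    by (intro face_cong_mult vertex_sum_in_polys insert.IH) (use insert.prems F' in auto)
  also have "\<dots> = (\<Prod>i\<in>insert i M. vertex_sum G i) * ?X"
    using insert.hyps by (simp add: mult.assoc)
  finally show ?case .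
qed

text \<open>
  The defining relation with the variable of the meet \<open>(F, T \<inter> U)\<close> replaced by a product of vertex
  sums, which \<open>Var_mult_above_cong\<close> allows in front of each upper bound.
\<close>

lemma Var_mult_Var_cong:
  assumes CT: "(C, T) \<in> carrier P" and DU: "(D, U) \<in> carrier P"
  shows "(Var (C, T) * Var (D, U) :: ('a, 'k::field) face_poly)
    \<approx> (\<Prod>i\<in>T \<inter> U. vertex_sum G i) * (\<Sum>E | E \<in> comps (T \<union> U) \<and> E \<subseteq> C \<inter> D. Var (E, T \<union> U))"
proof (cases "C \<inter> D = {}")
  case True
  then have "{E. E \<in> comps (T \<union> U) \<and> E \<subseteq> C \<inter> D} = {}" using comps_nonempty by blast
  then show ?thesis using Var_mult_disjoint_cong[OF CT DU True] by (simp only: sum.empty mult_zero_right)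
next
  case False
  obtain F where F: "F \<in> comps (T \<inter> U)" "C \<union> D \<subseteq> F"
    "(Var (C, T) * Var (D, U) :: ('a, 'k) face_poly)
      \<approx> Var (F, T \<inter> U) * (\<Sum>E | E \<in> comps (T \<union> U) \<and> E \<subseteq> C \<inter> D. Var (E, T \<union> U))"
    by (rule Var_mult_meet_cong[OF CT DU False])
  note F(3)
  also have "(Var (F, T \<inter> U) :: ('a, 'k) face_poly) * (\<Sum>E | E \<in> comps (T \<union> U) \<and> E \<subseteq> C \<inter> D. Var (E, T \<union> U))
      \<approx> (\<Prod>i\<in>T \<inter> U. vertex_sum G i) * (\<Sum>E | E \<in> comps (T \<union> U) \<and> E \<subseteq> C \<inter> D. Var (E, T \<union> U))"
    unfolding sum_distrib_left
  proof (rule face_cong_sum)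
    fix E assume E: "E \<in> {E. E \<in> comps (T \<union> U) \<and> E \<subseteq> C \<inter> D}"
    then have "(E, T \<union> U) \<in> carrier P"
      using union_psubset[OF CT DU False] by (auto simp: carrier_graph_poset)
    then show "Var (F, T \<inter> U) * Var (E, T \<union> U)
        \<approx> (\<Prod>i\<in>T \<inter> U. vertex_sum G i) * (Var (E, T \<union> U) :: ('a, 'k) face_poly)"
      using E F CT finite_psubset_verts
      by (intro Var_mult_above_cong) (auto simp: carrier_graph_poset)
  qed
  finally show ?thesis .
qed

section \<open>Standard monomials\<close>

text \<open>
  The exponents are lowered by one because the variable of \<open>(C, keys m)\<close> already contributes each
  vertex of \<open>keys m\<close> once. At a vertex of \<open>C\<close> the restriction is thus exactly the monomial \<open>m\<close> in the
  differences \<open>x\<^sub>i - x\<^sub>v\<close>.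
\<close>

definition standard_monomial ::
    "('a \<Rightarrow>\<^sub>0 nat) \<Rightarrow> 'a set \<Rightarrow> ('a set \<times> 'a set, 'k::field) mpoly" where
  "standard_monomial m C = Var (C, keys m) * (\<Prod>i\<in>keys m. vertex_sum G i ^ (lookup m i - 1))"

definition standard_indices :: "(('a \<Rightarrow>\<^sub>0 nat) \<times> 'a set) set" where
  "standard_indices = {(m, C). (C, keys m) \<in> carrier P}"

lemma standard_monomial_in_polys:
  "(m, C) \<in> standard_indices \<Longrightarrow> standard_monomial m C \<in> polys (carrier P)"
  unfolding standard_monomial_def
  by (intro polys_mult polys_prod polys_power vertex_sum_in_polys) (auto simp: standard_indices_def)

lemma facet_restriction_standard_monomial:
  assumes mC: "(m, C) \<in> standard_indices" and v: "v \<in> verts G"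
  shows "facet_restriction v (standard_monomial m C)
    = (if v \<in> C then power_product (\<lambda>i. Var i - Var v :: ('a, 'k::field) mpoly) m else 0)"
proof -
  have "keys m \<subset> verts G" using mC by (simp add: standard_indices_def carrier_graph_poset)
  then have "facet_restriction v (vertex_sum G i) = (Var i - Var v :: ('a, 'k) mpoly)" if "i \<in> keys m" for i
    using that v by (intro facet_restriction_vertex_sum) auto
  then have "facet_restriction v (standard_monomial m C) = (if v \<in> C then \<Prod>i\<in>keys m. Var i - Var v else 0)
      * (\<Prod>i\<in>keys m. (Var i - Var v :: ('a, 'k) mpoly) ^ (lookup m i - 1))"
    unfolding standard_monomial_def by simp
  also have "(if v \<in> C then \<Prod>i\<in>keys m. Var i - Var v else 0)
      * (\<Prod>i\<in>keys m. (Var i - Var v) ^ (lookup m i - 1))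
    = (if v \<in> C then \<Prod>i\<in>keys m. (Var i - Var v) * (Var i - Var v) ^ (lookup m i - 1) else 0)"
    by (simp add: prod.distrib)
  also have "(\<Prod>i\<in>keys m. (Var i - Var v) * (Var i - Var v) ^ (lookup m i - 1))
      = power_product (\<lambda>i. Var i - Var v) m"
    unfolding power_product_def
    by (intro prod.cong refl) (simp add: in_keys_iff flip: power_Suc)
  finally show ?thesis .
qed

text \<open>
  Setting \<open>x\<^sub>v = 0\<close> turns the differences \<open>x\<^sub>i - x\<^sub>v\<close> back into the variables \<open>x\<^sub>i\<close> and does not affect
  the coefficient at a monomial without \<open>x\<^sub>v\<close>.
\<close>

lemma lookup_facet_restriction_standard_monomial:
  assumes mC: "(m, C) \<in> standard_indices" and v: "v \<in> verts G" "v \<notin> keys m'"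
  shows "lookup (facet_restriction v (standard_monomial m C)) m' = (if v \<in> C \<and> m = m' then 1 else (0::'k::field))"
proof (cases "v \<in> C")
  case True
  let ?p = "power_product (\<lambda>i. Var i - Var v :: ('a, 'k) mpoly) m"
  from True have "v \<notin> keys m"
    using mC comps_subset by (fastforce simp: standard_indices_def carrier_graph_poset)
  then have "set_to_zero {v} ?p = power_product Var m"
    unfolding power_product_def set_to_zero_def by (auto intro!: prod.cong)
  then have "lookup ?p m' = lookup (power_product Var m :: ('a, 'k) mpoly) m'"
    using v lookup_set_to_zero[of "{v}" ?p m'] by simp
  also have "\<dots> = (if m = m' then 1 else (0::'k))"
    by (simp add: power_product_Var lookup_single when_def)
  finally show ?thesis unfolding facet_restriction_standard_monomial[OF mC v(1)] using True by simp
qed (simp add: facet_restriction_standard_monomial[OF mC v(1)])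

text \<open>
  Restriction reads off the coefficients of a combination of standard monomials; in particular
  these are linearly independent modulo the face ideal.
\<close>

lemma lookup_facet_restriction_combination:
  fixes c :: "('a \<Rightarrow>\<^sub>0 nat) \<times> 'a set \<Rightarrow> 'k::field"
  assumes A: "finite A" "A \<subseteq> standard_indices"
    and v: "v \<in> C" "C \<in> comps (keys m)"
  shows "lookup (facet_restriction v (\<Sum>k\<in>A. Const (c k) * (case k of (m, C) \<Rightarrow> standard_monomial m C))) m
    = (if (m, C) \<in> A then c (m, C) else 0)"
proof -
  have v': "v \<in> verts G" "v \<notin> keys m" using v comps_subset by auto
  have "lookup (facet_restriction v (\<Sum>k\<in>A. Const (c k) * (case k of (m, C) \<Rightarrow> standard_monomial m C))) m
      = (\<Sum>k\<in>A. c k * lookup (facet_restriction v (case k of (m, C) \<Rightarrow> standard_monomial m C)) m)"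
    by (simp add: lookup_sum lookup_Const_mult)
  also have "\<dots> = (\<Sum>k\<in>A. if k = (m, C) then c (m, C) else 0)"
  proof (intro sum.cong refl)
    fix k assume k: "k \<in> A"
    obtain m' C' where k': "k = (m', C')" by (cases k)
    have mC: "(m', C') \<in> standard_indices" using k k' A by auto
    have iff: "v \<in> C' \<and> m' = m \<longleftrightarrow> k = (m, C)"
      using mC v comps_disjoint[of C "keys m" C' v] k'
      by (auto simp: standard_indices_def carrier_graph_poset)
    have eq: "lookup (facet_restriction v (standard_monomial m' C')) m = (if k = (m, C) then 1 else (0::'k))"
      unfolding lookup_facet_restriction_standard_monomial[OF mC v'] iff ..
    show "c k * lookup (facet_restriction v (case k of (m, C) \<Rightarrow> standard_monomial m C)) m
        = (if k = (m, C) then c (m, C) else 0)"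
      unfolding k' prod.case eq[unfolded k'] by auto
  qed
  finally show ?thesis using A by simp
qed

text \<open>
  Multiplying by the variable of \<open>(D, U)\<close> raises the exponents of the vertices in \<open>U\<close> by one. For
  vertices in \<open>keys m \<inter> U\<close> the additional factor is the vertex sum supplied by \<open>Var_mult_Var_cong\<close>;
  for the others the exponent becomes one, which the variable of \<open>(E, keys m \<union> U)\<close> accounts for.
\<close>

lemma Var_mult_standard_monomial_cong:
  assumes mC: "(m, C) \<in> standard_indices" and DU: "(D, U) \<in> carrier P"
  shows "(standard_monomial m C * Var (D, U) :: ('a, 'k::field) face_poly)
    \<approx> (\<Sum>E | E \<in> comps (keys m \<union> U) \<and> E \<subseteq> C \<inter> D.
        standard_monomial (m + (\<Sum>i\<in>U. Poly_Mapping.single i 1)) E)"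
proof -
  let ?T = "keys m" and ?n = "m + (\<Sum>i\<in>U. Poly_Mapping.single i (1::nat))"
  let ?\<theta> = "vertex_sum G :: 'a \<Rightarrow> ('a, 'k) face_poly"
  let ?Q = "\<Prod>i\<in>?T. ?\<theta> i ^ (lookup m i - 1)"
  have CT: "(C, ?T) \<in> carrier P" using mC by (simp add: standard_indices_def)
  have U: "finite U" using DU finite_psubset_verts by (auto simp: carrier_graph_poset)
  note lookup_n = lookup_add lookup_sum_single_one[OF U]
  have keys_n: "keys ?n = ?T \<union> U" by (rule keys_add_sum_single_one[OF U])
  have "(\<Prod>i\<in>?T \<union> U. ?\<theta> i ^ (lookup ?n i - 1))
      = (\<Prod>i\<in>?T \<union> U. (if i \<in> ?T then ?\<theta> i ^ (lookup m i - 1) else 1) * (if i \<in> ?T \<inter> U then ?\<theta> i else 1))"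
  proof (intro prod.cong refl)
    fix i assume "i \<in> ?T \<union> U"
    then show "?\<theta> i ^ (lookup ?n i - 1)
        = (if i \<in> ?T then ?\<theta> i ^ (lookup m i - 1) else 1) * (if i \<in> ?T \<inter> U then ?\<theta> i else 1)"
      by (auto simp: lookup_n in_keys_iff simp del: One_nat_def simp flip: power_Suc2)
  qed
  also have "\<dots> = ?Q * (\<Prod>i\<in>?T \<inter> U. ?\<theta> i)"
    unfolding prod.distrib using U
    by (intro arg_cong2[where f = "(*)"] prod.mono_neutral_cong_right) auto
  finally have *: "(\<Prod>i\<in>?T \<union> U. ?\<theta> i ^ (lookup ?n i - 1)) = ?Q * (\<Prod>i\<in>?T \<inter> U. ?\<theta> i)" .
  have Q: "standard_monomial ?n E = (?Q * (\<Prod>i\<in>?T \<inter> U. ?\<theta> i)) * Var (E, ?T \<union> U)" for E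
    unfolding standard_monomial_def keys_n * by (rule mult.commute)
  have "standard_monomial m C * Var (D, U) = ?Q * (Var (C, ?T) * Var (D, U))"
    by (simp add: standard_monomial_def mult_ac)
  also have "\<dots> \<approx> ?Q * ((\<Prod>i\<in>?T \<inter> U. ?\<theta> i) * (\<Sum>E | E \<in> comps (?T \<union> U) \<and> E \<subseteq> C \<inter> D. Var (E, ?T \<union> U)))"
    by (intro face_cong_mult Var_mult_Var_cong CT DU polys_prod polys_power vertex_sum_in_polys)
  also have "\<dots> = (\<Sum>E | E \<in> comps (?T \<union> U) \<and> E \<subseteq> C \<inter> D. standard_monomial ?n E)"
    unfolding Q sum_distrib_left[symmetric] by (simp only: mult.assoc)
  finally show ?thesis .
qed

definition standard_combinations :: "('a set \<times> 'a set, 'k::field) mpoly set" where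
  "standard_combinations = {p. \<exists>A c. finite A \<and> A \<subseteq> standard_indices \<and>
    p \<approx> (\<Sum>k\<in>A. Const (c k) * (case k of (m, C) \<Rightarrow> standard_monomial m C))}"

lemma standard_combinationsI:
  assumes "finite A" "A \<subseteq> standard_indices"
    and "p \<approx> (\<Sum>k\<in>A. Const (c k) * (case k of (m, C) \<Rightarrow> standard_monomial m C))"
  shows "p \<in> standard_combinations"
  unfolding standard_combinations_def
  by (intro CollectI exI[of _ A] exI[of _ c] conjI assms)

lemma standard_combinations_cong:
  "p \<approx> q \<Longrightarrow> q \<in> standard_combinations \<Longrightarrow> p \<in> standard_combinations"
  unfolding standard_combinations_def using face_cong_trans by blast

lemma standard_combinations_add:
  assumes "p \<in> standard_combinations" "q \<in> standard_combinations"
  shows "p + q \<in> standard_combinations"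
proof -
  let ?e = "\<lambda>k. case k of (m, C) \<Rightarrow> standard_monomial m C"
  obtain A c where A: "finite A" "A \<subseteq> standard_indices" "p \<approx> (\<Sum>k\<in>A. Const (c k) * ?e k)"
    using assms(1) unfolding standard_combinations_def by blast
  obtain B d where B: "finite B" "B \<subseteq> standard_indices" "q \<approx> (\<Sum>k\<in>B. Const (d k) * ?e k)"
    using assms(2) unfolding standard_combinations_def by blast
  \<comment> \<open>Both combinations are extended by zero to the union of their index sets.\<close>
  let ?c = "\<lambda>k. (if k \<in> A then c k else 0) + (if k \<in> B then d k else 0)"
  have "(\<Sum>k\<in>A. Const (c k) * ?e k) = (\<Sum>k\<in>A \<union> B. Const (if k \<in> A then c k else 0) * ?e k)"
    using A B by (intro sum.mono_neutral_cong_left) auto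
  moreover have "(\<Sum>k\<in>B. Const (d k) * ?e k) = (\<Sum>k\<in>A \<union> B. Const (if k \<in> B then d k else 0) * ?e k)"
    using A B by (intro sum.mono_neutral_cong_left) auto
  ultimately have "p + q \<approx> (\<Sum>k\<in>A \<union> B. Const (?c k) * ?e k)"
    using face_cong_add[OF A(3) B(3)] unfolding Const_add distrib_right sum.distrib by simp
  with A B show ?thesis
    by (intro standard_combinationsI[where A = "A \<union> B" and c = ?c]) auto
qed

lemma standard_combinations_zero: "0 \<in> standard_combinations"
  by (rule standard_combinationsI[where A = "{}"]) auto

lemma standard_combinations_sum:
  "(\<And>i. i \<in> A \<Longrightarrow> f i \<in> standard_combinations) \<Longrightarrow> sum f A \<in> standard_combinations"
  by (induction A rule: infinite_finite_induct)
    (auto intro: standard_combinations_add standard_combinations_zero)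

lemma standard_monomial_in_combinations:
  assumes "(m, C) \<in> standard_indices"
  shows "Const c * standard_monomial m C \<in> standard_combinations"
  by (rule standard_combinationsI[where A = "{(m, C)}" and c = "\<lambda>_. c"]) (use assms in auto)

lemma polys_in_standard_combinations:
  assumes "p \<in> polys (carrier P)" shows "p \<in> standard_combinations"
  using assms
proof (induction p rule: mpoly_induct)
  case (Const c)
  have "Const c \<approx> Const c * standard_monomial 0 (verts G)"
    using face_cong_mult[OF polys_Const Var_bottom_cong]
    by (auto simp: standard_monomial_def intro: face_cong_sym)
  moreover have "(0, verts G) \<in> standard_indices"
    using bottom_in_carrier by (simp add: standard_indices_def)
  ultimately show ?case
    using standard_combinations_cong standard_monomial_in_combinations by metis
next
  case (add p q)
  then show ?case by (simp add: standard_combinations_add)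
next
  case (mult_Var p s)
  let ?e = "\<lambda>k. case k of (m, C) \<Rightarrow> standard_monomial m C"
  obtain A c where A: "finite A" "A \<subseteq> standard_indices" "p \<approx> (\<Sum>k\<in>A. Const (c k) * ?e k)"
    using mult_Var.IH unfolding standard_combinations_def by blast
  obtain D U where s: "s = (D, U)" by (cases s)
  have DU: "(D, U) \<in> carrier P" using mult_Var.hyps s by simp
  have "Var s * p \<approx> Var s * (\<Sum>k\<in>A. Const (c k) * ?e k)"
    by (rule face_cong_mult[OF _ A(3)]) (use mult_Var.hyps in simp)
  then have eq: "p * Var s \<approx> (\<Sum>k\<in>A. Const (c k) * (?e k * Var s))"
    by (simp add: sum_distrib_left mult_ac)
  have "Const (c k) * (?e k * Var s) \<in> standard_combinations" if "k \<in> A" for k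
  proof -
    obtain m C where k: "k = (m, C)" by (cases k)
    have mC: "(m, C) \<in> standard_indices" using that A k by auto
    let ?n = "m + (\<Sum>i\<in>U. Poly_Mapping.single i (1::nat))"
    let ?S = "{E. E \<in> comps (keys m \<union> U) \<and> E \<subseteq> C \<inter> D}"
    have "Const (c k) * (?e k * Var s) \<approx> Const (c k) * (\<Sum>E\<in>?S. standard_monomial ?n E)"
      unfolding k s using face_cong_mult[OF polys_Const Var_mult_standard_monomial_cong[OF mC DU]] by simp
    also have "\<dots> = (\<Sum>E\<in>?S. Const (c k) * standard_monomial ?n E)"
      by (rule sum_distrib_left)
    finally have eq: "Const (c k) * (?e k * Var s) \<approx> (\<Sum>E\<in>?S. Const (c k) * standard_monomial ?n E)" .
    have "(?n, E) \<in> standard_indices" if E: "E \<in> ?S" for E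
    proof -
      have U: "finite U" using DU finite_psubset_verts by (auto simp: carrier_graph_poset)
      have "keys ?n = keys m \<union> U" by (rule keys_add_sum_single_one[OF U])
      moreover have "C \<inter> D \<noteq> {}" using E comps_nonempty by blast
      moreover have "(C, keys m) \<in> carrier P" using mC by (simp add: standard_indices_def)
      ultimately show ?thesis
        using union_psubset DU E by (simp add: standard_indices_def carrier_graph_poset)
    qed
    then have "(\<Sum>E\<in>?S. Const (c k) * standard_monomial ?n E) \<in> standard_combinations"
      by (intro standard_combinations_sum standard_monomial_in_combinations)
    with eq show ?thesis by (rule standard_combinations_cong)
  qed
  then show ?case
    by (intro standard_combinations_cong[OF eq] standard_combinations_sum)
qed

section \<open>The face ring is the ring of splines\<close>

text \<open>
  Modulo the face ideal \<open>p\<close> is a combination of standard monomials, and its restrictions, being zero,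
  force all coefficients of the combination to be zero.
\<close>

lemma facet_restriction_eq_zero_imp_face_ideal:
  assumes p: "p \<in> polys (carrier P)" and zero: "\<And>v. v \<in> verts G \<Longrightarrow> facet_restriction v p = 0"
  shows "p \<in> face_ideal P"
proof -
  let ?e = "\<lambda>k. case k of (m, C) \<Rightarrow> standard_monomial m C"
  obtain A c where A: "finite A" "A \<subseteq> standard_indices" and pA: "p \<approx> (\<Sum>k\<in>A. Const (c k) * ?e k)"
    using polys_in_standard_combinations[OF p] unfolding standard_combinations_def by blast
  have loc: "facet_restriction v (\<Sum>k\<in>A. Const (c k) * ?e k) = 0" if "v \<in> verts G" for v
    using facet_restriction_face_ideal[OF pA[unfolded face_cong_def] that] zero[OF that]
    unfolding facet_restriction_simps(2) by simp
  have "c k = 0" if "k \<in> A" for k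
  proof -
    obtain m C where k: "k = (m, C)" by (cases k)
    have C: "C \<in> comps (keys m)" using that A k by (auto simp: standard_indices_def carrier_graph_poset)
    obtain v where v: "v \<in> C" using comps_nonempty[OF C] by blast
    then have "v \<in> verts G" using comps_subset[OF C] by auto
    then show ?thesis
      using lookup_facet_restriction_combination[OF A v C, of c] loc that k by simp
  qed
  then have "(\<Sum>k\<in>A. Const (c k) * ?e k) = 0" by (intro sum.neutral) auto
  then show ?thesis using pA by (simp add: face_cong_def)
qed

text \<open>
  The coefficient of the standard monomial of \<open>(m, C)\<close> in \<open>p\<close> has to be the coefficient at \<open>m\<close> that
  all \<open>f v\<close> with \<open>v \<in> C\<close> have in common. Only finitely many monomials occur in the family \<open>f\<close>.
\<close>

lemma ex_facet_restriction_eq_spline: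
  assumes f: "spline f"
  obtains p where "p \<in> polys (carrier P)" "\<And>v. v \<in> verts G \<Longrightarrow> facet_restriction v p = f v"
proof -
  let ?e = "\<lambda>k. case k of (m, C) \<Rightarrow> standard_monomial m C"
  define M where "M = (\<Union>v\<in>verts G. keys (f v))"
  define A where "A = {(m, C). m \<in> M \<and> (m, C) \<in> standard_indices}"
  \<comment> \<open>Every vertex of \<open>C\<close> gives the same coefficient.\<close>
  define c where "c = (\<lambda>(m, C). lookup (f (SOME v. v \<in> C)) m)"
  define p where "p = (\<Sum>k\<in>A. Const (c k) * ?e k)"
  have "A \<subseteq> M \<times> Pow (verts G)"
    using comps_subset by (auto simp: A_def standard_indices_def carrier_graph_poset)
  then have fin: "finite A"
    by (rule finite_subset) (simp add: M_def)
  have sub: "A \<subseteq> standard_indices" by (auto simp: A_def)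
  have p: "p \<in> polys (carrier P)"
    unfolding p_def using sub
    by (intro polys_sum polys_mult) (auto intro: standard_monomial_in_polys)
  have "facet_restriction v p = f v" if v: "v \<in> verts G" for v
  proof (rule difference_polys_eqI[OF facet_restriction_in_difference_polys[OF p v] _ v])
    show fv: "f v \<in> difference_polys" using f v by (simp add: spline_def)
    fix m :: "'a \<Rightarrow>\<^sub>0 nat" assume m: "v \<notin> keys m"
    obtain C where C: "C \<in> comps (keys m)" "v \<in> C" using comps_cover[OF v m] by blast
    have "lookup (facet_restriction v p) m = (if (m, C) \<in> A then c (m, C) else 0)"
      unfolding p_def by (rule lookup_facet_restriction_combination[OF fin sub C(2,1)])
    also have "\<dots> = lookup (f v) m"
    proof (cases "(m, C) \<in> A")
      case True
      have "(SOME v. v \<in> C) \<in> C" using C by (rule_tac someI)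
      then show ?thesis using True spline_lookup_eq[OF f C(1) _ C(2)] by (simp add: c_def)
    next
      case False
      have "m \<notin> keys (f v)"
      proof
        assume mk: "m \<in> keys (f v)"
        then have "keys m \<subseteq> verts G" using fv by (auto simp: difference_polys_def polys_iff)
        \<comment> \<open>The vertex \<open>v\<close> is missing from \<open>keys m\<close>, so \<open>keys m\<close> may be the second entry of a pair.\<close>
        then have "keys m \<subset> verts G" using v m by blast
        then have "(m, C) \<in> A"
          using mk v C by (auto simp: A_def M_def standard_indices_def carrier_graph_poset)
        with False show False by simp
      qed
      with False show ?thesis by (simp add: in_keys_iff)
    qed
    finally show "lookup (facet_restriction v p) m = lookup (f v) m" .
  qed
  with p show thesis by (rule that)
qed

section \<open>Closure properties of splines\<close>

lemma difference_polys_zero [simp]: "0 \<in> difference_polys"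
  and difference_polys_one [simp]: "1 \<in> difference_polys"
  and difference_polys_Const [simp]: "Const c \<in> difference_polys"
  by (auto simp: difference_polys_def)

lemma difference_polys_add [simp]: "f \<in> difference_polys \<Longrightarrow> g \<in> difference_polys \<Longrightarrow> f + g \<in> difference_polys"
  and difference_polys_mult [simp]: "f \<in> difference_polys \<Longrightarrow> g \<in> difference_polys \<Longrightarrow> f * g \<in> difference_polys"
  and difference_polys_uminus [simp]: "f \<in> difference_polys \<Longrightarrow> - f \<in> difference_polys"
  by (auto simp: difference_polys_def)

lemma difference_polys_Var_diff [simp]:
  "u \<in> verts G \<Longrightarrow> v \<in> verts G \<Longrightarrow> Var u - Var v \<in> difference_polys"
  by (auto simp: difference_polys_def)

lemma spline_zero: "spline (\<lambda>_. 0)"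
  by (auto simp: spline_def)

lemma spline_add:
  assumes "spline f" "spline g"
  shows "spline (\<lambda>v. f v + g v)"
proof -
  have eq: "f u + g u - (f v + g v) = (f u - f v) + (g u - g v)" for u v by simp
  show ?thesis using assms unfolding spline_def eq by (auto intro: dvd_add)
qed

lemma spline_mult:
  assumes "r \<in> difference_polys" "spline f"
  shows "spline (\<lambda>v. r * f v)"
  using assms by (auto simp: spline_def simp flip: right_diff_distrib)

section \<open>The face ring as a module\<close>

abbreviation face_class ::
    "('a, 'k::field) face_poly \<Rightarrow> ('a, 'k) face_poly set" where
  "face_class p \<equiv> face_ideal P +>\<^bsub>mpoly_ring (carrier P)\<^esub> p"

lemma carrier_face_module: "carrier (face_module G) = face_class ` polys (carrier P)"
  by (auto simp: face_module_def face_ring_def ring.defs FactRing_def A_RCOSETS_def')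

lemma face_module_add:
  assumes "p \<in> polys (carrier P)" "q \<in> polys (carrier P)"
  shows "face_class p \<oplus>\<^bsub>face_module G\<^esub> face_class q = face_class (p + q)"
  using ring_hom_add[OF ideal.rcos_ring_hom[OF ideal_face_ideal] assms]
  by (simp add: face_module_def face_ring_def ring.defs)

lemma face_module_zero: "\<zero>\<^bsub>face_module G\<^esub> = face_class 0"
  by (simp add: face_module_def face_ring_def ring.defs FactRing_def a_r_coset_def')

lemma face_module_smult:
  assumes "p \<in> polys (carrier P)"
  shows "r \<odot>\<^bsub>face_module G\<^esub> face_class p = face_class (mpoly_subst (vertex_sum G) r * p)"
proof -
  have "mpoly_subst (vertex_sum G) r \<in> polys (carrier P)"
    by (intro mpoly_subst_in_polys[OF polys_UNIV] vertex_sum_in_polys)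
  from ring_hom_mult[OF ideal.rcos_ring_hom[OF ideal_face_ideal] this assms]
  show ?thesis by (simp add: face_module_def face_ring_def ring.defs)
qed

text \<open>
  The face ideal is the common kernel of the restrictions, so its cosets are the fibres of the map to
  splines. The isomorphism can therefore be given without a choice of representatives.
\<close>

lemma face_class_eq_fibre:
  assumes p: "p \<in> polys (carrier P)"
  shows "face_class p = {q \<in> polys (carrier P). \<forall>v\<in>verts G. facet_restriction v q = facet_restriction v p}"
proof (intro Set.set_eqI iffI)
  fix q assume "q \<in> face_class p"
  then obtain i where i: "i \<in> face_ideal P" "q = i + p"
    by (auto simp: a_r_coset_def')
  moreover have "i \<in> polys (carrier P)"
    by (rule ideal.Icarr[OF ideal_face_ideal i(1)])
  ultimately show "q \<in> {q \<in> polys (carrier P). \<forall>v\<in>verts G. facet_restriction v q = facet_restriction v p}"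
    using p facet_restriction_face_ideal by auto
next
  fix q assume q: "q \<in> {q \<in> polys (carrier P). \<forall>v\<in>verts G. facet_restriction v q = facet_restriction v p}"
  then have "q - p \<in> face_ideal P"
    using p by (intro facet_restriction_eq_zero_imp_face_ideal) auto
  then have "\<exists>i\<in>face_ideal P. q = i + p" by (rule bexI[rotated]) simp
  then show "q \<in> face_class p" by (auto simp: a_r_coset_def')
qed

end

section \<open>The isomorphism\<close>

locale numbered_connected_graph = connected_graph G for G :: "(nat, 'b) pre_digraph" (structure) +
  fixes l :: nat
  assumes verts_eq: "verts G = {1..l}"
begin

lemma one_in_verts: "1 \<in> {1..l}"
  using comps_empty comps_nonempty[of "verts G" "{}"] by (auto simp: verts_eq)

text \<open>
  The generators are translation-invariant. Conversely an invariant polynomial equals the result of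
  substituting \<open>x\<^sub>i - x\<^sub>1\<close> for \<open>x\<^sub>i\<close> in it, a polynomial expression in the generators.
\<close>

lemma carrier_R_ring: "carrier (R_ring l) = (difference_polys :: (nat, 'k::field) mpoly set)"
proof -
  let ?S = "S_ring l :: (nat, 'k) mpoly ring"
  let ?H = "range Const \<union> {Var i - Var j :: (nat, 'k) mpoly | i j. 1 \<le> i \<and> i < j \<and> j \<le> l}"
  have inv: "\<ominus>\<^bsub>?S\<^esub> f = - f" if "f \<in> polys {1..l}" for f
    using mpoly_ring_a_inv[OF that] by (simp add: S_ring_def)
  have diff_polys: "f \<in> difference_polys \<Longrightarrow> f \<in> polys {1..l}" for f :: "(nat, 'k) mpoly"
    by (simp add: difference_polys_def verts_eq)
  have 1: "f \<in> difference_polys" if "f \<in> generate_ring ?S ?H" for f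
    using that
  proof (induction rule: generate_ring.induct)
    case (incl h)
    then show ?case by (auto simp: verts_eq intro!: difference_polys_Var_diff)
  next
    case (a_inv h)
    then show ?case using inv[OF diff_polys[OF a_inv.IH]] by (simp only: difference_polys_uminus)
  qed (simp_all add: S_ring_def)
  have Var: "Var i - Var 1 \<in> generate_ring ?S ?H" if "i \<in> {1..l}" for i
  proof (cases "i = 1")
    case True
    have "Const 0 \<in> generate_ring ?S ?H" by (rule generate_ring.incl) blast
    with True show ?thesis by simp
  next
    case False
    then have "Var 1 - Var i \<in> generate_ring ?S ?H"
      using that by (intro generate_ring.incl UnI2 CollectI exI[of _ 1] exI[of _ i]) auto
    from generate_ring.a_inv[OF this] show ?thesis
      using that one_in_verts by (subst (asm) inv) auto
  qed
  have subst: "mpoly_subst (\<lambda>i. Var i - Var 1) f \<in> generate_ring ?S ?H" if "f \<in> polys {1..l}" for f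
    using that
  proof (induction f rule: mpoly_induct)
    case (Const c)
    then show ?case by (auto intro: generate_ring.incl)
  next
    case (add p q)
    then show ?case using generate_ring.eng_add[of _ ?S ?H] by (simp add: S_ring_def)
  next
    case (mult_Var p v)
    then show ?case using generate_ring.eng_mult[of _ ?S ?H, OF _ Var] by (simp add: S_ring_def)
  qed
  have 2: "f \<in> generate_ring ?S ?H" if "f \<in> difference_polys" for f
  proof -
    have "mpoly_subst (\<lambda>i. Var i - Var 1) f = f"
      using that one_in_verts unfolding difference_polys_def verts_eq by blast
    moreover have "mpoly_subst (\<lambda>i. Var i - Var 1) f \<in> generate_ring ?S ?H"
      by (rule subst[OF diff_polys[OF that]])
    ultimately show ?thesis by simp
  qed
  show ?thesis
    unfolding R_ring_def using 1 2 by auto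
qed

lemma R_ring_simps [simp]:
  "monoid.mult (R_ring l) = (*)" "one (R_ring l) = 1"
  "zero (R_ring l) = 0" "add (R_ring l) = (+)"
  by (simp_all add: R_ring_def S_ring_def)

lemma cring_R_ring: "cring (R_ring l :: (nat, 'k::field) mpoly ring)"
proof (rule cringI)
  have "\<exists>q\<in>difference_polys. q + p = 0" if "p \<in> difference_polys" for p :: "(nat, 'k) mpoly"
    by (rule bexI[of _ "- p"]) (use that in auto)
  then show "abelian_group (R_ring l :: (nat, 'k) mpoly ring)"
    by (intro abelian_groupI) (auto simp: carrier_R_ring add_ac)
  show "comm_monoid (R_ring l :: (nat, 'k) mpoly ring)"
    by (intro comm_monoidI) (auto simp: carrier_R_ring mult_ac)
qed (simp add: ring_distribs)

lemma carrier_D_R: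
  "carrier (D_R l G) = derivation l ` {f :: nat \<Rightarrow> (nat, 'k::field) mpoly. spline f}"
proof -
  have edge: "derivation l f (Var u - Var v) \<in> PIdl\<^bsub>S_ring l\<^esub> (Var u - Var v) \<longleftrightarrow> Var u - Var v dvd f u - f v"
    if uv: "(u, v) \<in> arcs_ends G" and f: "\<And>v. v \<in> verts G \<Longrightarrow> f v \<in> difference_polys"
    for f :: "nat \<Rightarrow> (nat, 'k) mpoly" and u v
  proof -
    have "u \<in> {1..l}" "v \<in> {1..l}" using adj_in_verts[OF uv] by (auto simp: verts_eq)
    moreover have "f u \<in> polys {1..l}" "f v \<in> polys {1..l}"
      using f adj_in_verts[OF uv] by (auto simp: difference_polys_def verts_eq)
    ultimately show ?thesis
      by (simp add: S_ring_def derivation_Var_diff PIdl_iff_dvd polys_diff)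
  qed
  show ?thesis
  proof (intro Set.set_eqI iffI)
    fix \<theta> :: "(nat, 'k) mpoly \<Rightarrow> (nat, 'k) mpoly" assume "\<theta> \<in> carrier (D_R l G)"
    then have log: "\<theta> \<in> log_derivations l G" and "\<theta> \<in> derivations l difference_polys"
      by (auto simp: D_R_def carrier_R_ring)
    then obtain f where f: "\<theta> = derivation l f" "f \<in> {1..l} \<rightarrow> difference_polys"
      unfolding derivations_def by blast
    from f(2) have fd: "\<And>v. v \<in> verts G \<Longrightarrow> f v \<in> difference_polys"
      unfolding verts_eq by blast
    have "spline f"
      using log fd edge[OF _ fd] by (auto simp: spline_def log_derivations_def f(1))
    with f show "\<theta> \<in> derivation l ` {f. spline f}" by auto
  next
    fix \<theta> :: "(nat, 'k) mpoly \<Rightarrow> (nat, 'k) mpoly" assume "\<theta> \<in> derivation l ` {f. spline f}"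
    then obtain f where f: "\<theta> = derivation l f" "spline f" by auto
    then have fd: "\<And>v. v \<in> verts G \<Longrightarrow> f v \<in> difference_polys" by (simp add: spline_def)
    then have "f \<in> {1..l} \<rightarrow> carrier (R_ring l)" "f \<in> {1..l} \<rightarrow> carrier (S_ring l)"
      by (auto simp: carrier_R_ring verts_eq S_ring_def difference_polys_def)
    then have "\<theta> \<in> derivations l (carrier (R_ring l))" "\<theta> \<in> derivations l (carrier (S_ring l))"
      by (auto simp: derivations_def f(1))
    then show "\<theta> \<in> carrier (D_R l G)"
      using f edge[OF _ fd] by (auto simp: D_R_def log_derivations_def spline_def)
  qed
qed

lemma module_D_R: "module (R_ring l :: (nat, 'k::field) mpoly ring) (D_R l G)"
proof (rule moduleI[OF cring_R_ring])
  have "spline (\<lambda>v. - 1 * f v)" if "spline f" for f :: "nat \<Rightarrow> (nat, 'k) mpoly"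
    by (rule spline_mult[OF _ that]) (use difference_polys_uminus[OF difference_polys_one] in simp)
  then have "\<exists>g. spline g \<and> derivation l (\<lambda>i. g i + f i) = derivation l (\<lambda>_. 0)"
    if "spline f" for f :: "nat \<Rightarrow> (nat, 'k) mpoly"
    using that by (intro exI[of _ "\<lambda>v. - 1 * f v"]) auto
  then show "abelian_group (D_R l G :: ((nat, 'k) mpoly, _) module)"
    by (intro abelian_groupI) (auto simp: carrier_D_R D_R_add D_R_zero spline_add spline_zero add_ac)
qed (auto simp: carrier_D_R carrier_R_ring D_R_add D_R_smult spline_mult ring_distribs mult.assoc)

lemma module_face_module: "module (R_ring l :: (nat, 'k::field) mpoly ring) (face_module G)"
proof (rule moduleI[OF cring_R_ring])
  have "\<exists>q\<in>polys (carrier P). face_class (q + p) = face_class 0"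
    if "p \<in> polys (carrier P)" for p :: "(nat, 'k) face_poly"
    by (rule bexI[of _ "- p"]) (use that in auto)
  then show "abelian_group (face_module G :: ((nat, 'k) mpoly, _) module)"
    by (intro abelian_groupI) (auto simp: carrier_face_module face_module_add face_module_zero add_ac)
next
  fix r :: "(nat, 'k) mpoly" and x :: "(nat, 'k) face_poly set"
  assume "x \<in> carrier (face_module G)"
  then show "r \<odot>\<^bsub>face_module G\<^esub> x \<in> carrier (face_module G)"
    by (auto simp: carrier_face_module face_module_smult
        intro!: imageI polys_mult mpoly_subst_in_polys[OF polys_UNIV] vertex_sum_in_polys)
qed (auto simp: carrier_face_module face_module_add face_module_smult ring_distribs mult.assoc
      mpoly_subst_in_polys[OF polys_UNIV] vertex_sum_in_polys)

text \<open>
  The isomorphism sends \<open>\<theta>\<close> to the set of all polynomials whose restriction to each \<open>v\<close> is the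
  coefficient \<open>\<theta> x\<^sub>v\<close>. This set is a coset of the face ideal by \<open>face_class_eq_fibre\<close>, since a polynomial
  with these restrictions exists by \<open>ex_facet_restriction_eq_spline\<close>.
\<close>

lemma isomorphic_modules_D_R_face_module:
  "isomorphic_modules (R_ring l :: (nat, 'k::field) mpoly ring) (D_R l G) (face_module G)"
proof -
  let ?R = "R_ring l :: (nat, 'k) mpoly ring"
  let ?D = "D_R l G :: ((nat, 'k) mpoly, _) module" and ?F = "face_module G :: ((nat, 'k) mpoly, _) module"
  define \<Phi> where "\<Phi> \<theta> = {q \<in> polys (carrier P). \<forall>v\<in>verts G. facet_restriction v q = \<theta> (Var v)}"
    for \<theta> :: "(nat, 'k) mpoly \<Rightarrow> (nat, 'k) mpoly"
  have \<Phi>: "\<Phi> (derivation l f) = face_class p"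
    if "p \<in> polys (carrier P)" "\<And>v. v \<in> verts G \<Longrightarrow> facet_restriction v p = f v" for f p
    unfolding \<Phi>_def face_class_eq_fibre[OF that(1)]
    using that(2) by (auto simp: verts_eq derivation_Var)
  have ex: "\<exists>f p. \<theta> = derivation l f \<and> spline f \<and> p \<in> polys (carrier P) \<and> (\<forall>v\<in>verts G. facet_restriction v p = f v)"
    if "\<theta> \<in> carrier ?D" for \<theta>
  proof -
    obtain f where f: "\<theta> = derivation l f" "spline f" using \<open>\<theta> \<in> carrier ?D\<close> by (auto simp: carrier_D_R)
    obtain p where "p \<in> polys (carrier P)" "\<And>v. v \<in> verts G \<Longrightarrow> facet_restriction v p = f v"
      using ex_facet_restriction_eq_spline[OF f(2)] by metis
    with f show ?thesis by metis
  qed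
  have inj: "inj_on \<Phi> (carrier ?D)"
  proof (rule inj_onI)
    fix \<theta> \<eta> assume \<theta>: "\<theta> \<in> carrier ?D" and \<eta>: "\<eta> \<in> carrier ?D" and eq: "\<Phi> \<theta> = \<Phi> \<eta>"
    obtain f p where f: "\<theta> = derivation l f" "p \<in> polys (carrier P)" "\<And>v. v \<in> verts G \<Longrightarrow> facet_restriction v p = f v"
      using ex[OF \<theta>] by metis
    obtain g where g: "\<eta> = derivation l g" using ex[OF \<eta>] by metis
    have "p \<in> \<Phi> \<theta>" using f by (simp add: \<Phi>_def verts_eq derivation_Var)
    then have "p \<in> \<Phi> \<eta>" using eq by simp
    then have "f v = g v" if "v \<in> {1..l}" for v
      using that f(3) g by (simp add: \<Phi>_def verts_eq derivation_Var)
    then show "\<theta> = \<eta>" unfolding f g by (rule derivation_cong)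
  qed
  have surj: "\<Phi> ` carrier ?D = carrier ?F"
  proof (intro Set.set_eqI iffI)
    fix c assume "c \<in> \<Phi> ` carrier ?D"
    then obtain \<theta> where \<theta>: "\<theta> \<in> carrier ?D" "c = \<Phi> \<theta>" by auto
    obtain f p where f: "\<theta> = derivation l f" "p \<in> polys (carrier P)" "\<And>v. v \<in> verts G \<Longrightarrow> facet_restriction v p = f v"
      using ex[OF \<theta>(1)] by metis
    then show "c \<in> carrier ?F" using \<Phi>[OF f(2,3)] \<theta>(2) by (auto simp: carrier_face_module)
  next
    fix c assume "c \<in> carrier ?F"
    then obtain p where p: "p \<in> polys (carrier P)" "c = face_class p" by (auto simp: carrier_face_module)
    then have "c = \<Phi> (derivation l (\<lambda>v. facet_restriction v p))" using \<Phi>[OF p(1)] by simp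
    moreover have "derivation l (\<lambda>v. facet_restriction v p) \<in> carrier ?D"
      using spline_facet_restriction[OF p(1)] by (simp add: carrier_D_R)
    ultimately show "c \<in> \<Phi> ` carrier ?D" by blast
  qed
  have add: "\<Phi> (\<theta> \<oplus>\<^bsub>?D\<^esub> \<eta>) = \<Phi> \<theta> \<oplus>\<^bsub>?F\<^esub> \<Phi> \<eta>" if \<theta>: "\<theta> \<in> carrier ?D" and \<eta>: "\<eta> \<in> carrier ?D" for \<theta> \<eta>
  proof -
    obtain f p where f: "\<theta> = derivation l f" "p \<in> polys (carrier P)" "\<And>v. v \<in> verts G \<Longrightarrow> facet_restriction v p = f v"
      using ex[OF \<theta>] by metis
    obtain g q where g: "\<eta> = derivation l g" "q \<in> polys (carrier P)" "\<And>v. v \<in> verts G \<Longrightarrow> facet_restriction v q = g v"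
      using ex[OF \<eta>] by metis
    have "\<Phi> (derivation l (\<lambda>i. f i + g i)) = face_class (p + q)"
      using f g by (intro \<Phi>) auto
    then show ?thesis
      by (simp add: f(1) g(1) D_R_add \<Phi>[OF f(2,3)] \<Phi>[OF g(2,3)] face_module_add f(2) g(2))
  qed
  have smult: "\<Phi> (r \<odot>\<^bsub>?D\<^esub> \<theta>) = r \<odot>\<^bsub>?F\<^esub> \<Phi> \<theta>" if r: "r \<in> carrier ?R" and \<theta>: "\<theta> \<in> carrier ?D" for r \<theta>
  proof -
    obtain f p where f: "\<theta> = derivation l f" "p \<in> polys (carrier P)" "\<And>v. v \<in> verts G \<Longrightarrow> facet_restriction v p = f v"
      using ex[OF \<theta>] by metis
    have "mpoly_subst (vertex_sum G) r \<in> polys (carrier P)"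
      by (intro mpoly_subst_in_polys[OF polys_UNIV] vertex_sum_in_polys)
    then have "\<Phi> (derivation l (\<lambda>i. r * f i)) = face_class (mpoly_subst (vertex_sum G) r * p)"
      using f r by (intro \<Phi>) (auto simp: carrier_R_ring facet_restriction_subst_vertex_sum)
    then show ?thesis
      by (simp add: f(1) D_R_smult \<Phi>[OF f(2,3)] face_module_smult f(2))
  qed
  have "\<Phi> \<in> module_iso ?R ?D ?F"
    using inj surj add smult by (simp add: module_iso_def bij_betw_def)
  then show ?thesis
    using module_D_R module_face_module by (auto simp: isomorphic_modules_def)
qed

end

theorem theorem1p1:
  fixes l :: nat and G :: "(nat, 'b) pre_digraph"
  assumes "1 \<le> l"
    and "graph G"
    and "verts G = {1..l}"
    and "connected G"
  shows "isomorphic_modules (R_ring l :: (nat, 'k::field) mpoly ring) (D_R l G) (face_module G)"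
proof -
  interpret numbered_connected_graph G l
    using assms by (intro numbered_connected_graph.intro connected_graph.intro
        connected_graph_axioms.intro numbered_connected_graph_axioms.intro)
  show ?thesis by (rule isomorphic_modules_D_R_face_module)
qed

end
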